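(* Assume $\widehat\beta^{ok}$ satisfies a $\mathcal{T}(f,v_* )$ residual tail condition for $\beta^*$ and $\Delta\ge(b_1+b_2)\tau$. Suppose $\rho\ge0$ satisfies $$\rho\le\sqrt{\frac{b_1}{2^7a_0d_{\max}}}$$ and $\max\big(\frac{a_1\tau}4,\frac{b_1\tau}{4d_{\max}}\big)\le\frac1{v_*}$. Then the LLA algorithm for the problem $\min_{\beta\in\mathbb{R}^D}\frac12\|\widehat\beta^{ok}-\beta\|_2^2+s_\tau(\beta)$, initialized by $\widehat\beta^{init}$, converges to the block oracle $\widehat\beta^{o}$ after two steps with probability at least $1-\delta_1-\delta_2-\delta_3$, where $$\delta_1=\mathbb{P}\big(\|\mathcal{L}(|\widehat\beta^{init}|-|\beta^*|)\|_{op}\ge C_\rho\tau\big),\quad C_\rho=\min\Big(\rho,\frac1{2^6}\sqrt{\frac{a_1}{a_0d_{\max}}},\frac{b_1}{b_1+b_2}\Big)(b_1+b_2),$$ $$\delta_2=(D-|\mathcal{S}|)\,f\Big(n,\frac{a_1\tau}{4d_{\max}}\Big),\qquad \delta_3=|\mathcal{S}|\,f\Big(n,\frac{b_1\tau}{4d_{\max}}\Big).$$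
   Context: Notation. $D=\binom d2$; vectors $x\in\mathbb{R}^D$ are indexed by unordered pairs $(ij)$, $i\ne j\in[d]$. $\mathcal{A}(x)\in\mathbb{R}^{d\times d}$ is the symmetric matrix with zero diagonal and entries $\mathcal{A}(x)_{ij}=x_{(ij)}$; $\mathcal{L}(x)=\mathrm{diag}(\mathcal{A}(x)\mathbf 1_d)-\mathcal{A}(x)$. $|x|$ is the entrywise absolute value; $\|\cdot\|_{op}$ is the spectral norm; $\lambda_{(j)}$ is the $j$-th smallest eigenvalue. The connected components of $x$ are those of the graph on $[d]$ with edge $ij$ iff $x_{(ij)}\neq0$ (isolated vertices count). Tail condition. Let $v_*\in[0,\infty)$, with $1/0:=+\infty$, and let $f:\mathbb{N}\times\mathbb{R}_+\to\mathbb{R}_+$ be monotonically decreasing in both arguments for $t\in(0,1/v_*]$, with the convention $f(n,t)=1$ for $t\notin(0,1/v_*]$. A random vector $\widehat\beta^{ok}\in\mathbb{R}^D$ (depending on a sample size $n$) satisfies a $\mathcal{T}(f,v_* )$ residual tail condition if for each $\ell\in[D]$, $\mathbb{P}(|\widehat\beta^{ok}_\ell-\beta^*_\ell|>t)\le f(n,t)$ for all $t\in(0,1/v_*]$. SCAD-like penalty. Given $a_0\ge a_1>0$, $b_2>b_1>0$ and a tuning parameter $\tau$, $g_\tau:[0,\infty)\to\mathbb{R}$ satisfies: (1) $g_\tau$ is increasing and concave with $g_\tau(0)=0$; (2) $g_\tau$ is differentiable on $(0,\infty)$, and $g_\tau'(0):=g_\tau'(0+)=a_0\tau$; (3) $g_\tau'(t)\ge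 a_1\tau$ for $t\in(0,b_1\tau]$; (4) $g_\tau'(t)=0$ for $t\ge b_2\tau$. The FCLS penalty is $s_\tau(\beta)=\frac12\sum_{i=1}^dg_\tau(\lambda_i(\mathcal{L}(|\beta|)))$. LLA algorithm for $\ell+s_\tau$. For $V\in\mathbb{R}^{d\times d}$, $w\in\mathbb{R}^d$ let $\mathcal{M}(V,w)_{(ij)}=\sum_kw_k(V_{ik}-V_{jk})^2$. A step from $b$: let $V$ be an orthonormal matrix of eigenvectors of $\mathcal{L}(|b|)$ with eigenvalues $\lambda$, $M=\mathcal{M}(V,g_\tau'(\lambda))$; the result is the minimizer over $\beta$ of $\ell(\beta)+\frac12\sum_{(ij)}M_{(ij)}|\beta_{(ij)}|$. The algorithm iterates this from the (random) initializer $\widehat\beta^{init}$; it converges to $\widehat\beta^{o}$ after two steps if the second and all later iterates equal $\widehat\beta^{o}$. Target and oracle. $\beta^*\in\mathbb{R}^D$, $\beta^*\neq0$; $K$ is its number of connected components (isolated vertices included), $d_{\max}$ the largest number of nodes in a component, $\mathcal{S}$ the set of pairs $(ij)$, $i\neq j$, in the same component, $\mathcal{S}^c$ its complement, and $\Delta=\lambda_{(K+1)}(\mathcal{L}(|\beta^*|))$. The block oracle $\widehat\beta^{o}$ is the minimizer of $\frac12\|\widehat\beta^{ok}-\beta\|_2^2$ subject to $\beta_{\mathcal{S}^c}=0$. *)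

theory Defs
  imports
    "HOL-Probability.Probability"
    "HOL-Computational_Algebra.Polynomial"
    "HOL-Library.Numeral_Type"
begin

section \<open>Vectors indexed by unordered pairs\<close>

text \<open>
  The index set of the nodes is a finite type \<open>'d\<close>; the index set of the vectors is the type of
  its two-element subsets. The class \<^class>\<open>card2\<close> (at least two elements) is what makes
  that type nonempty; for a single node there is no nonzero vector of this kind.
\<close>

typedef 'd edge = "{e :: 'd::card2 set. card e = 2}"
proof -
  have "2 \<le> card (UNIV :: 'd set)"
    by (rule two_le_card)
  then obtain e :: "'d set" where "card e = 2"
    by (rule obtain_subset_with_card_n)
  then show ?thesis
    by blast
qed

instance edge :: (card2) finite
proof
  have "finite (range (Rep_edge :: 'a edge \<Rightarrow> 'a set))"
    by (rule finite)
  then show "finite (UNIV :: 'a edge set)"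
    by (rule finite_imageD) (rule inj_onI, simp only: Rep_edge_inject)
qed

text \<open>The pair \<open>(ij)\<close>; only meaningful for \<open>i \<noteq> j\<close>.\<close>

definition edge :: "'d::card2 \<Rightarrow> 'd \<Rightarrow> 'd edge" where
  "edge i j = Abs_edge {i, j}"

lemma Rep_edge_edge: "i \<noteq> j \<Longrightarrow> Rep_edge (edge i j) = {i, j}"
  by (simp add: edge_def Abs_edge_inverse)

lemma edge_exhaust:
  obtains i j where "i \<noteq> j" "e = edge i j"
proof -
  have "card (Rep_edge e) = 2"
    using Rep_edge[of e] by simp
  then obtain i j where "Rep_edge e = {i, j}" "i \<noteq> j"
    by (auto simp: card_2_iff)
  from this(1) have "e = edge i j"
    using Rep_edge_inverse[of e] by (simp add: edge_def)
  with \<open>i \<noteq> j\<close> show ?thesis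
    by (rule that)
qed

lemma edge_eq_iff:
  assumes "i \<noteq> j" "k \<noteq> l"
  shows "edge i j = edge k l \<longleftrightarrow> i = k \<and> j = l \<or> i = l \<and> j = k"
proof -
  have "edge i j = edge k l \<longleftrightarrow> {i, j} = {k, l}"
    unfolding Rep_edge_edge[OF assms(1), symmetric] Rep_edge_edge[OF assms(2), symmetric]
    by (rule Rep_edge_inject[symmetric])
  then show ?thesis
    by (simp only: doubleton_eq_iff)
qed

lemma card_edge: "CARD('d::card2 edge) = CARD('d) choose 2"
proof -
  have "bij_betw Rep_edge (UNIV :: 'd edge set) {e. card e = 2}"
    by (simp add: bij_betw_def inj_on_def Rep_edge_inject
        type_definition.Rep_range[OF type_definition_edge])
  then have "CARD('d edge) = card {e :: 'd set. card e = 2}"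
    by (rule bij_betw_same_card)
  also have "\<dots> = CARD('d) choose 2"
    using n_subsets[of "UNIV :: 'd set" 2] by simp
  finally show ?thesis .
qed


section \<open>Laplacian and connected components\<close>

definition adjacency :: "real ^ ('d::card2) edge \<Rightarrow> real ^ 'd::card2 ^ 'd::card2" where
  "adjacency x = (\<chi> i j. if i = j then 0 else x $ edge i j)"

definition diag :: "real ^ 'd::finite \<Rightarrow> real ^ 'd ^ 'd" where
  "diag u = (\<chi> i j. if i = j then u $ i else 0)"

definition laplacian :: "real ^ ('d::card2) edge \<Rightarrow> real ^ 'd::card2 ^ 'd::card2" where
  "laplacian x = diag (adjacency x *v 1) - adjacency x"

definition spectral_norm :: "real ^ 'd::finite ^ 'd \<Rightarrow> real" where
  "spectral_norm A = onorm ((*v) A)"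

definition connectivity :: "real ^ ('d::card2) edge \<Rightarrow> ('d \<times> 'd) set" where
  "connectivity x = {(i, j). i \<noteq> j \<and> x $ edge i j \<noteq> 0}\<^sup>*"

definition graph_components :: "real ^ ('d::card2) edge \<Rightarrow> 'd set set" where
  "graph_components x = UNIV // connectivity x"

definition max_component_size :: "real ^ ('d::card2) edge \<Rightarrow> nat" where
  "max_component_size x = Max (card ` graph_components x)"

definition within_pairs :: "real ^ ('d::card2) edge \<Rightarrow> 'd edge set" where
  "within_pairs x = {edge i j | i j. i \<noteq> j \<and> (i, j) \<in> connectivity x}"


section \<open>Eigenvalues\<close>

definition charpoly :: "real ^ 'd::finite ^ 'd \<Rightarrow> real poly" where
  "charpoly A = det (mat [:0, 1:] - map_matrix (\<lambda>a. [:a:]) A)"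

text \<open>The real eigenvalues with algebraic multiplicity, all of them if the matrix is symmetric.\<close>

definition eigenvalues :: "real ^ 'd::finite ^ 'd \<Rightarrow> real multiset" where
  "eigenvalues A = proots (charpoly A)"

text \<open>The \<open>j\<close>-th smallest eigenvalue, counted from \<open>j = 1\<close>.\<close>

definition eigenvalue_nth :: "nat \<Rightarrow> real ^ 'd::finite ^ 'd \<Rightarrow> real" where
  "eigenvalue_nth j A = sorted_list_of_multiset (eigenvalues A) ! (j - 1)"

text \<open>The columns of \<open>V\<close> are an orthonormal basis of eigenvectors, \<open>\<Lambda>\<close> lists their eigenvalues.\<close>

definition eigenbasis :: "real ^ 'd::finite ^ 'd \<Rightarrow> real ^ 'd ^ 'd \<Rightarrow> real ^ 'd \<Rightarrow> bool" where
  "eigenbasis A V \<Lambda> \<longleftrightarrow>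
     orthogonal_matrix V \<and> (\<forall>k. A *v column k V = \<Lambda> $ k *\<^sub>R column k V)"


section \<open>Penalty\<close>

text \<open>The derivative of the penalty on \<open>[0, \<infinity>)\<close>; at \<open>0\<close> it is the right limit \<open>g'(0+)\<close>.\<close>

definition pen_deriv :: "(real \<Rightarrow> real) \<Rightarrow> real \<Rightarrow> real" where
  "pen_deriv g t = (if t = 0 then Lim (at_right 0) (deriv g) else deriv g t)"

definition scad_like ::
  "real \<Rightarrow> real \<Rightarrow> real \<Rightarrow> real \<Rightarrow> real \<Rightarrow> (real \<Rightarrow> real) \<Rightarrow> bool" where
  "scad_like a0 a1 b1 b2 \<tau> g \<longleftrightarrow>
     mono_on {0..} g \<and> concave_on {0..} g \<and> g 0 = 0 \<and>
     (\<forall>t>0. g differentiable (at t)) \<and>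
     (deriv g \<longlongrightarrow> a0 * \<tau>) (at_right 0) \<and>
     (\<forall>t. 0 < t \<and> t \<le> b1 * \<tau> \<longrightarrow> pen_deriv g t \<ge> a1 * \<tau>) \<and>
     (\<forall>t\<ge>0. t \<ge> b2 * \<tau> \<longrightarrow> pen_deriv g t = 0)"

lemma scad_like_pen_deriv_0: "scad_like a0 a1 b1 b2 \<tau> g \<Longrightarrow> pen_deriv g 0 = a0 * \<tau>"
  unfolding scad_like_def pen_deriv_def by (simp add: tendsto_Lim)

definition fcls_penalty :: "(real \<Rightarrow> real) \<Rightarrow> real ^ ('d::card2) edge \<Rightarrow> real" where
  "fcls_penalty g \<beta> = 1/2 * (\<Sum>t\<in>#eigenvalues (laplacian \<bar>\<beta>\<bar>). g t)"


section \<open>The LLA algorithm\<close>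

definition edge_weights :: "real ^ 'd::card2 ^ 'd::card2 \<Rightarrow> real ^ 'd::card2 \<Rightarrow> real ^ ('d::card2) edge" where
  "edge_weights V w =
     (THE m. \<forall>i j. i \<noteq> j \<longrightarrow> m $ edge i j = (\<Sum>k\<in>UNIV. w $ k * (V $ i $ k - V $ j $ k)\<^sup>2))"

lemma edge_weights_nth:
  fixes V :: "real ^ 'd::card2 ^ 'd::card2"
  assumes "i \<noteq> j"
  shows "edge_weights V w $ edge i j = (\<Sum>k\<in>UNIV. w $ k * (V $ i $ k - V $ j $ k)\<^sup>2)"
proof -
  define F where "F i j = (\<Sum>k\<in>UNIV. w $ k * (V $ i $ k - V $ j $ k)\<^sup>2)" for i j
  have F_sym: "F i j = F j i" for i j
    unfolding F_def by (subst power2_commute) (rule refl)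
  have "\<forall>e. \<exists>x. \<forall>i j. i \<noteq> j \<longrightarrow> e = edge i j \<longrightarrow> x = F i j"
  proof
    fix e :: "'d edge"
    obtain p q where "p \<noteq> q" "e = edge p q"
      by (rule edge_exhaust)
    then show "\<exists>x. \<forall>i j. i \<noteq> j \<longrightarrow> e = edge i j \<longrightarrow> x = F i j"
      by (intro exI[of _ "F p q"]) (auto simp: edge_eq_iff intro: F_sym)
  qed
  from choice[OF this] obtain h where h: "\<And>e i j. i \<noteq> j \<Longrightarrow> e = edge i j \<Longrightarrow> h e = F i j"
    by blast
  have "\<exists>!m :: real ^ 'd edge. \<forall>i j. i \<noteq> j \<longrightarrow> m $ edge i j = F i j"
  proof (rule ex1I)
    show "\<forall>i j. i \<noteq> j \<longrightarrow> (\<chi> e. h e) $ edge i j = F i j"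
      by (simp add: h)
  next
    fix m :: "real ^ 'd edge"
    assume m: "\<forall>i j. i \<noteq> j \<longrightarrow> m $ edge i j = F i j"
    have "m $ e = h e" for e
    proof -
      obtain p q where "p \<noteq> q" "e = edge p q"
        by (rule edge_exhaust)
      then show ?thesis
        using m h by simp
    qed
    then show "m = (\<chi> e. h e)"
      by (simp add: vec_eq_iff)
  qed
  from theI'[OF this] have "\<forall>i j. i \<noteq> j \<longrightarrow> edge_weights V w $ edge i j = F i j"
    unfolding edge_weights_def F_def .
  with assms show ?thesis
    by (simp add: F_def)
qed

text \<open>
  One step of the local linear approximation for \<open>l + fcls_penalty g\<close>, as a relation between
  consecutive iterates because neither the eigenbasis nor (for general \<open>l\<close>) the minimizer is unique.
\<close>

definition lla_step ::
  "(real ^ 'd edge \<Rightarrow> real) \<Rightarrow> (real \<Rightarrow> real) \<Rightarrow> real ^ 'd edge \<Rightarrow> real ^ ('d::card2) edge \<Rightarrow> bool" where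
  "lla_step l g b b' \<longleftrightarrow>
     (\<exists>V \<Lambda>. eigenbasis (laplacian \<bar>b\<bar>) V \<Lambda> \<and>
        is_arg_min
          (\<lambda>\<beta>. l \<beta> + 1/2 * (\<Sum>e\<in>UNIV. edge_weights V (\<chi> k. pen_deriv g (\<Lambda> $ k)) $ e * \<bar>\<beta> $ e\<bar>))
          (\<lambda>_. True) b')"

definition lla_run ::
  "(real ^ 'd edge \<Rightarrow> real) \<Rightarrow> (real \<Rightarrow> real) \<Rightarrow> real ^ 'd edge \<Rightarrow> (nat \<Rightarrow> real ^ ('d::card2) edge) \<Rightarrow> bool" where
  "lla_run l g b0 b \<longleftrightarrow> b 0 = b0 \<and> (\<forall>k. lla_step l g (b k) (b (Suc k)))"

text \<open>
  The algorithm can be run, and whatever eigenbases are chosen along the way, the second and all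
  later iterates are \<open>x\<close>.
\<close>

definition lla_converges_after_two_steps ::
  "(real ^ 'd edge \<Rightarrow> real) \<Rightarrow> (real \<Rightarrow> real) \<Rightarrow> real ^ 'd edge \<Rightarrow> real ^ ('d::card2) edge \<Rightarrow> bool" where
  "lla_converges_after_two_steps l g b0 x \<longleftrightarrow>
     (\<exists>b. lla_run l g b0 b) \<and> (\<forall>b. lla_run l g b0 b \<longrightarrow> (\<forall>k\<ge>2. b k = x))"

definition ls_loss :: "real ^ ('d::card2) edge \<Rightarrow> real ^ 'd edge \<Rightarrow> real" where
  "ls_loss y \<beta> = 1/2 * (norm (y - \<beta>))\<^sup>2"

definition block_oracle :: "real ^ ('d::card2) edge \<Rightarrow> real ^ 'd edge \<Rightarrow> real ^ 'd edge" where
  "block_oracle \<beta>s y = arg_min (ls_loss y) (\<lambda>\<beta>. \<forall>e. e \<notin> within_pairs \<beta>s \<longrightarrow> \<beta> $ e = 0)"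


section \<open>Tail condition\<close>

text \<open>The interval \<open>(0, 1/v]\<close>; in the extended reals \<open>1/0 = \<infinity>\<close>.\<close>

definition tail_range :: "real \<Rightarrow> real set" where
  "tail_range v = {t. 0 < t \<and> ereal t \<le> 1 / ereal v}"

definition tail_function :: "real \<Rightarrow> (nat \<Rightarrow> real \<Rightarrow> real) \<Rightarrow> bool" where
  "tail_function v f \<longleftrightarrow>
     (\<forall>n. \<forall>t\<ge>0. f n t \<ge> 0) \<and>
     (\<forall>t\<in>tail_range v. antimono (\<lambda>n. f n t)) \<and>
     (\<forall>n. antimono_on (tail_range v) (f n)) \<and>
     (\<forall>n. \<forall>t\<ge>0. t \<notin> tail_range v \<longrightarrow> f n t = 1)"

definition residual_tail_condition ::
  "'o measure \<Rightarrow> (nat \<Rightarrow> real \<Rightarrow> real) \<Rightarrow> real \<Rightarrow> nat \<Rightarrow> real ^ 'e::finite \<Rightarrow> ('o \<Rightarrow> real ^ 'e) \<Rightarrow> bool" where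
  "residual_tail_condition M f v n \<beta>s Y \<longleftrightarrow>
     (\<forall>e. \<forall>t\<in>tail_range v. \<P>(\<omega> in M. \<bar>Y \<omega> $ e - \<beta>s $ e\<bar> > t) \<le> f n t)"

end

theory Submission
  imports Defs
begin

text \<open>
  One step of the algorithm soft-thresholds the data \<open>y\<close> at level \<open>M / 2\<close>, where the weight of the
  pair \<open>(ij)\<close> is \<open>M = (\<Sum>k. g'(\<lambda>\<^sub>k) * (v\<^sub>k \<bullet> z)\<^sup>2)\<close> with \<open>z = axis i 1 - axis j 1\<close> and \<open>v\<^sub>k\<close> the
  eigenvectors of the current Laplacian. The derivative \<open>g'\<close> lies between \<open>a1 * \<tau>\<close> and \<open>a0 * \<tau>\<close> on small
  eigenvalues and vanishes on large ones, so \<open>M\<close> measures how much of \<open>z\<close> lies in the low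
  eigenspace. The kernel of the true Laplacian consists of the vectors that are constant on each
  component. Hence \<open>z\<close> is orthogonal to the kernel if \<open>i\<close> and \<open>j\<close> share a component, and has
  a kernel part of squared length at least \<open>2 / dmax\<close> otherwise.

  Put \<open>\<Delta> = (b1 + b2) * \<tau>\<close> and let the initial Laplacian differ from the true one by \<open>c * \<Delta>\<close> in
  the spectral norm, where \<open>c\<close> is below each of the three quantities whose minimum enters \<open>C\<close>. The
  nonzero eigenvalues of the true Laplacian are at least \<open>\<Delta>\<close>. All eigenvalues of the initial one are at
  most \<open>c * \<Delta> < b1 * \<tau>\<close> or at least \<open>(1 - c) * \<Delta> > b2 * \<tau>\<close> (\<open>eigenvalue_separation\<close>), and the low eigenspace is close to the kernel in both directions:
  its overlap with the complement of the kernel is at most \<open>2 * c\<close>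
  (\<open>kernel_complement_low_part\<close>), and at most \<open>c / (1 - c)\<close> of the kernel escapes from it
  (\<open>kernel_vector_high_part\<close>). So after the first step the entries across components are exactly
  \<open>0\<close>, because their threshold is at least \<open>a1 * \<tau> / (4 * dmax)\<close>, while the entries within components
  move by at most \<open>b1 * \<tau> / (32 * dmax)\<close> (\<open>first_update_near_target\<close>).

  From then on the iterate is block diagonal and close to the target. Its Laplacian annihilates the
  block-constant vectors exactly, and by a bound on quadratic forms all its other eigenvalues are
  at least \<open>\<Delta> - b1 * \<tau> = b2 * \<tau>\<close>, where \<open>g'\<close> is \<open>0\<close> (\<open>same_kernel_eigenvalue_gap\<close>). The
  weights within components are therefore \<open>0\<close> and those across components at least
  \<open>2 * a0 * \<tau> / dmax\<close>, so the next step returns the block oracle (\<open>second_update_is_oracle\<close>). The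
  oracle is itself block diagonal and close to the target, hence a fixed point.

  The failure probabilities add up by a union bound. This needs the convergence event to be
  measurable although it quantifies over all eigenbases. A choice of eigenbasis is a point of the
  compact orthogonal group, and the update is continuous in it because the derivative of a
  differentiable concave function is continuous; so the complement of the event is a projection of
  an \<open>F\<^sub>\<sigma>\<close> set along a compact factor, which is Borel (\<open>borel_lla_converges\<close>).
\<close>

section \<open>Symmetric matrices and their eigenbases\<close>

lemma self_adjointD:
  fixes A :: "real^'d^'d"
  assumes "transpose A = A"
  shows "x \<bullet> (A *v y) = (A *v x) \<bullet> y"
  by (metis assms dot_lmul_matrix matrix_vector_mul_assoc transpose_matrix_vector vector_transpose_matrix)

text \<open>
  A maximizer of the Rayleigh quotient over the unit sphere of the subspace is an eigenvector. Working
  in an invariant subspace lets the spectral theorem be reached by splitting off one eigenvector at a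
  time.
\<close>

lemma symmetric_invariant_subspace_eigenvector:
  fixes A :: "real^'d^'d"
  assumes sym: "transpose A = A" and S: "subspace S" and inv: "\<And>x. x \<in> S \<Longrightarrow> A *v x \<in> S"
    and ne: "\<exists>x\<in>S. x \<noteq> 0"
  shows "\<exists>v \<mu>. v \<in> S \<and> norm v = 1 \<and> A *v v = \<mu> *\<^sub>R v"
proof -
  let ?K = "sphere 0 1 \<inter> S"
  have comp: "compact ?K"
    by (simp add: S closed_subspace compact_Int_closed)
  obtain x where x: "x \<in> S" "x \<noteq> 0" using ne by blast
  have nonempty: "?K \<noteq> {}"
  proof -
    have "(1 / norm x) *\<^sub>R x \<in> ?K" using x S by (simp add: subspace_scale)
    then show ?thesis by blast
  qed
  have cont: "continuous_on ?K (\<lambda>x. x \<bullet> (A *v x))"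
    by (intro continuous_intros)
  obtain v where v: "v \<in> ?K" and max: "\<And>y. y \<in> ?K \<Longrightarrow> y \<bullet> (A *v y) \<le> v \<bullet> (A *v v)"
    using continuous_attains_sup[OF comp nonempty cont] by blast
  define \<mu> where "\<mu> = v \<bullet> (A *v v)"
  have nv: "norm v = 1" "v \<in> S" using v by auto
  have bound: "y \<bullet> (A *v y) \<le> \<mu> * (norm y)\<^sup>2" if "y \<in> S" for y
  proof (cases "y = 0")
    case False
    have "(1 / norm y) *\<^sub>R y \<in> ?K" using that False S by (simp add: subspace_scale)
    from max[OF this] show ?thesis
      using False by (simp add: \<mu>_def matrix_vector_mult_scaleR field_simps power2_eq_square)
  qed simp
  define r where "r = A *v v - \<mu> *\<^sub>R v"
  have rS: "r \<in> S" unfolding r_def using nv S inv by (simp add: subspace_diff subspace_scale)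
  have "v \<bullet> r = 0"
    using nv by (simp add: r_def inner_diff_right \<mu>_def norm_eq_1)
  then have rv: "r \<bullet> v = 0" by (simp add: inner_commute)
  have rr: "r \<bullet> (A *v v) = r \<bullet> r"
    using rv by (simp add: r_def inner_diff_right)
  \<comment> \<open>Moving from the maximizer in the direction \<open>r\<close> increases the Rayleigh quotient at rate
    \<open>2 (r \<bullet> r)\<close>, so \<open>r = 0\<close>.\<close>
  have var: "2 * t * (r \<bullet> r) \<le> t\<^sup>2 * (\<mu> * (r \<bullet> r) - r \<bullet> (A *v r))" for t
  proof -
    have "(v + t *\<^sub>R r) \<bullet> (A *v (v + t *\<^sub>R r)) \<le> \<mu> * (norm (v + t *\<^sub>R r))\<^sup>2"
      using bound nv rS S by (simp add: subspace_add subspace_scale)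
    moreover have "v \<bullet> (A *v r) = r \<bullet> r"
      using self_adjointD[OF sym, of v r] rr by (simp add: inner_commute)
    moreover have "v \<bullet> v = 1" using nv by (simp add: norm_eq_1)
    moreover have "(norm (v + t *\<^sub>R r))\<^sup>2 = 1 + t\<^sup>2 * (r \<bullet> r)"
      using \<open>v \<bullet> r = 0\<close> rv \<open>v \<bullet> v = 1\<close> by (simp only: power2_norm_eq_inner)
        (simp add: inner_add_left inner_add_right power2_eq_square)
    ultimately show ?thesis using rr rv
      by (simp add: inner_add_left inner_add_right matrix_vector_right_distrib
          matrix_vector_mult_scaleR \<mu>_def[symmetric] power2_eq_square algebra_simps)
  qed
  have "r \<bullet> r = 0"
  proof (rule ccontr)
    assume "r \<bullet> r \<noteq> 0"
    then have pos: "r \<bullet> r > 0" by simp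
    define c where "c = \<bar>\<mu> * (r \<bullet> r) - r \<bullet> (A *v r)\<bar> + 1"
    have c: "c > 0" by (simp add: c_def)
    define t where "t = (r \<bullet> r) / c"
    have t: "t > 0" using pos c by (simp add: t_def)
    have "2 * t * (r \<bullet> r) \<le> t\<^sup>2 * c"
      using var[of t] by (rule order_trans) (intro mult_left_mono, auto simp: c_def)
    also have "\<dots> = t * (r \<bullet> r)" using c by (simp add: t_def power2_eq_square)
    finally show False using mult_pos_pos[OF t pos] by simp
  qed
  then have "A *v v = \<mu> *\<^sub>R v" by (simp add: r_def)
  with nv show ?thesis by blast
qed

lemma symmetric_orthonormal_eigenvectors:
  fixes A :: "real^'d^'d"
  assumes sym: "transpose A = A"
  shows "n \<le> CARD('d) \<Longrightarrow> \<exists>B. finite B \<and> card B = n \<and> pairwise orthogonal B \<and>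
           (\<forall>v\<in>B. norm v = 1 \<and> (\<exists>\<mu>. A *v v = \<mu> *\<^sub>R v))"
proof (induction n)
  case 0
  show ?case by (intro exI[of _ "{}"]) auto
next
  case (Suc n)
  then obtain B where B: "finite B" "card B = n" "pairwise orthogonal B"
      "\<And>v. v \<in> B \<Longrightarrow> norm v = 1" "\<And>v. v \<in> B \<Longrightarrow> \<exists>\<mu>. A *v v = \<mu> *\<^sub>R v"
    by (metis Suc_leD)
  let ?S = "{x. \<forall>v\<in>B. v \<bullet> x = 0}"
  have sub: "subspace ?S" by (auto simp: subspace_def inner_add_right)
  have inv: "A *v x \<in> ?S" if "x \<in> ?S" for x
  proof (intro CollectI ballI)
    fix v assume v: "v \<in> B"
    then obtain \<mu> where "A *v v = \<mu> *\<^sub>R v" using B by blast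
    then show "v \<bullet> (A *v x) = 0"
      using that v self_adjointD[OF sym, of v x] by simp
  qed
  have "dim (span B) < CARD('d)"
    using B(1,2) Suc.prems dim_le_card'[of B] by simp
  then have "span B \<noteq> UNIV" by (metis DIM_cart DIM_real dim_UNIV mult.right_neutral nat_neq_iff)
  then obtain a where a: "a \<noteq> 0" "\<forall>x\<in>span B. a \<bullet> x = 0"
    using span_not_univ_subset_hyperplane by blast
  then have "\<exists>x\<in>?S. x \<noteq> 0" by (intro bexI[of _ a]) (auto simp: span_base inner_commute)
  from symmetric_invariant_subspace_eigenvector[OF sym sub inv this]
  obtain v \<mu> where v: "v \<in> ?S" "norm v = 1" "A *v v = \<mu> *\<^sub>R v" by blast
  have "v \<notin> B"
    using v by (auto simp: norm_eq_1)
  then have "finite (insert v B)" "card (insert v B) = Suc n" using B by auto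
  moreover have "pairwise orthogonal (insert v B)"
    using B v by (auto simp: pairwise_insert orthogonal_def inner_commute)
  ultimately show ?case using B v by (intro exI[of _ "insert v B"]) auto
qed

theorem symmetric_eigenbasis_exists:
  fixes A :: "real^'d^'d"
  assumes "transpose A = A"
  shows "\<exists>V \<Lambda>. eigenbasis A V \<Lambda>"
proof -
  obtain B where B: "finite B" "card B = CARD('d)" "pairwise orthogonal B"
      "\<And>v. v \<in> B \<Longrightarrow> norm v = 1" "\<And>v. v \<in> B \<Longrightarrow> \<exists>\<mu>. A *v v = \<mu> *\<^sub>R v"
    using symmetric_orthonormal_eigenvectors[OF assms order_refl] by blast
  obtain h where h: "bij_betw h (UNIV :: 'd set) B"
    using B(1,2) finite_same_card_bij[of "UNIV::'d set" B] by auto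
  define V where "V = (\<chi> i k. h k $ i)"
  have col: "column k V = h k" for k by (simp add: V_def column_def)
  have hB: "h k \<in> B" for k using h by (auto simp: bij_betw_def)
  have inj: "h k = h l \<longleftrightarrow> k = l" for k l using h by (auto simp: bij_betw_def inj_on_def)
  have orth: "h k \<bullet> h l = (if k = l then 1 else 0)" for k l
    using B hB[of k] hB[of l] inj[of k l]
    by (auto simp: pairwise_def orthogonal_def norm_eq_1)
  have "transpose V ** V = mat 1"
    using orth by (simp add: matrix_matrix_mult_def vec_eq_iff mat_def V_def inner_vec_def transpose_def)
  then have "orthogonal_matrix V" by (simp add: orthogonal_matrix)
  moreover obtain m where "\<And>k. A *v h k = m k *\<^sub>R h k" using B(5)[OF hB] by metis
  ultimately have "eigenbasis A V (\<chi> k. m k)" by (simp add: eigenbasis_def col)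
  then show ?thesis by blast
qed

lemma eigenbasis_orthonormal:
  assumes "eigenbasis A V \<Lambda>"
  shows "column k V \<bullet> column l V = (if k = l then 1 else 0)"
proof -
  have "transpose V ** V = mat 1" using assms by (simp add: eigenbasis_def orthogonal_matrix)
  then have "(transpose V ** V) $ k $ l = mat 1 $ k $ l" by simp
  then show ?thesis
    by (simp add: matrix_matrix_mult_def mat_def column_def inner_vec_def transpose_def)
qed

lemma eigenbasis_eigenvector: "eigenbasis A V \<Lambda> \<Longrightarrow> A *v column k V = \<Lambda> $ k *\<^sub>R column k V"
  by (simp add: eigenbasis_def)

lemma orthogonal_matrix_parseval:
  fixes V :: "real^'d^'d"
  assumes "orthogonal_matrix V"
  shows "x \<bullet> y = (\<Sum>k\<in>UNIV. (column k V \<bullet> x) * (column k V \<bullet> y))"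
proof -
  have t: "(transpose V *v x) $ k = column k V \<bullet> x" for x k
    by (simp add: matrix_vector_mult_def transpose_def column_def inner_vec_def)
  have "V ** transpose V = mat 1" using assms by (simp add: orthogonal_matrix_def)
  then have "x \<bullet> y = x \<bullet> (V *v (transpose V *v y))"
    by (simp only: matrix_vector_mul_assoc matrix_vector_mul_lid)
  also have "\<dots> = (transpose V *v x) \<bullet> (transpose V *v y)"
    by (metis dot_lmul_matrix transpose_matrix_vector)
  finally show ?thesis by (simp only: inner_vec_def[of "transpose V *v x" "transpose V *v y"] t inner_real_def)
qed

lemma eigenbasis_parseval:
  "eigenbasis A V \<Lambda> \<Longrightarrow> x \<bullet> y = (\<Sum>k\<in>UNIV. (column k V \<bullet> x) * (column k V \<bullet> y))"
  by (simp add: eigenbasis_def orthogonal_matrix_parseval)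

lemma eigenbasis_norm:
  "eigenbasis A V \<Lambda> \<Longrightarrow> (norm x)\<^sup>2 = (\<Sum>k\<in>UNIV. (column k V \<bullet> x)\<^sup>2)"
  using eigenbasis_parseval[of A V \<Lambda> x x] by (simp add: power2_norm_eq_inner) (simp add: power2_eq_square)

lemma eigenbasis_coord_mult:
  assumes "eigenbasis A V \<Lambda>" "transpose A = A"
  shows "column k V \<bullet> (A *v x) = \<Lambda> $ k * (column k V \<bullet> x)"
  using self_adjointD[OF assms(2), of "column k V" x] eigenbasis_eigenvector[OF assms(1), of k]
  by simp

text \<open>
  Two real polynomials agree if their values do, so the determinant over the polynomial ring
  reduces to \<open>det (mat x - A)\<close> for real \<open>x\<close>, which an orthogonal change of basis diagonalizes.
\<close>

lemma charpoly_eigenbasis: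
  assumes "eigenbasis A V \<Lambda>"
  shows "charpoly A = (\<Prod>k\<in>UNIV. [:- \<Lambda> $ k, 1:])"
proof (rule poly_eq_poly_eq_iff[THEN iffD1], rule ext)
  fix x :: real
  have V: "transpose V ** V = mat 1" using assms by (simp add: eigenbasis_def orthogonal_matrix)
  have dV: "det (transpose V) * det V = 1"
    using arg_cong[OF V, of det] by (simp add: det_mul)
  have "poly (charpoly A) x = det (mat x - A)"
    unfolding charpoly_def det_def
    by (simp add: poly_sum poly_prod mat_def map_matrix_def if_distrib if_distribR poly_mult)
      (intro sum.cong refl arg_cong2[where f = "(*)"] prod.cong, auto simp: sign_def)
  also have "\<dots> = det (transpose V) * det (mat x - A) * det V"
    using dV by (simp add: mult.commute mult.left_commute)
  also have "\<dots> = det (transpose V ** (mat x - A) ** V)" by (simp add: det_mul)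
  also have "transpose V ** (mat x - A) ** V = (\<chi> k l. if k = l then x - \<Lambda> $ k else 0)"
  proof -
    have mv: "mat x *v v = x *\<^sub>R v" for v :: "real^'a"
      by (simp add: matrix_vector_mult_def mat_def vec_eq_iff if_distrib if_distribR cong: if_cong)
    have "(transpose V ** ((mat x - A) ** V)) $ k $ l = (if k = l then x - \<Lambda> $ k else 0)" for k l
    proof -
      have "(transpose V ** ((mat x - A) ** V)) $ k $ l = column k V \<bullet> ((mat x - A) *v column l V)"
        by (simp add: matrix_matrix_mult_def transpose_def column_def inner_vec_def matrix_vector_mult_def)
      also have "\<dots> = column k V \<bullet> ((x - \<Lambda> $ l) *\<^sub>R column l V)"
        using eigenbasis_eigenvector[OF assms, of l]
        by (simp add: matrix_vector_mult_diff_rdistrib mv scaleR_diff_left)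
      finally show ?thesis by (simp add: eigenbasis_orthonormal[OF assms])
    qed
    then show ?thesis by (simp add: vec_eq_iff matrix_mul_assoc)
  qed
  also have "det \<dots> = (\<Prod>k\<in>UNIV. x - \<Lambda> $ k)" by (subst det_diagonal) auto
  also have "\<dots> = poly (\<Prod>k\<in>UNIV. [:- \<Lambda> $ k, 1:]) x" by (simp add: poly_prod)
  finally show "poly (charpoly A) x = poly (\<Prod>k\<in>UNIV. [:- \<Lambda> $ k, 1:]) x" .
qed

lemma eigenvalues_eigenbasis:
  assumes "eigenbasis A V \<Lambda>"
  shows "eigenvalues A = image_mset (($) \<Lambda>) (mset_set UNIV)"
proof -
  have "eigenvalues A = (\<Sum>k\<in>UNIV. {#\<Lambda> $ k#})"
    unfolding eigenvalues_def charpoly_eigenbasis[OF assms] by (subst proots_prod) auto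
  also have "\<dots> = image_mset (($) \<Lambda>) (mset_set UNIV)"
    by (induction rule: finite_induct[OF finite]) auto
  finally show ?thesis .
qed

text \<open>
  The zeros come first in the sorted list of eigenvalues and fill at least the first \<open>K\<close> places, so
  every nonzero eigenvalue stands at place \<open>K + 1\<close> or later. This turns the hypothesis on one ordered
  eigenvalue into a gap that can be used with any eigenbasis.
\<close>

lemma eigenvalue_nth_Suc_le:
  fixes A :: "real^'d^'d"
  assumes eb: "eigenbasis A V \<Lambda>" and nonneg: "\<And>k. 0 \<le> \<Lambda> $ k"
    and K: "K \<le> card {k. \<Lambda> $ k = 0}" and pos: "\<Lambda> $ k \<noteq> 0"
  shows "eigenvalue_nth (K + 1) A \<le> \<Lambda> $ k"
proof -
  let ?L = "sorted_list_of_multiset (eigenvalues A)"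
  have ms: "mset ?L = image_mset (($) \<Lambda>) (mset_set UNIV)"
    by (simp add: eigenvalues_eigenbasis[OF eb])
  have mem: "x \<in> set ?L \<longleftrightarrow> x \<in> range (($) \<Lambda>)" for x
    using arg_cong[OF ms, of set_mset] by auto
  obtain p where p: "p < length ?L" "?L ! p = \<Lambda> $ k"
    using mem[of "\<Lambda> $ k"] by (metis in_set_conv_nth rangeI)
  have srt: "sorted ?L" by simp
  have "K \<le> p"
  proof (rule ccontr)
    assume "\<not> K \<le> p"
    have pos_after: "?L ! q > 0" if "q \<ge> p" "q < length ?L" for q
      using sorted_nth_mono[OF srt that] p nonneg[of k] pos by linarith
    then have "{i. i < length ?L \<and> ?L ! i = 0} \<subseteq> {..<p}"
    proof (intro subsetI)
      fix i assume "i \<in> {i. i < length ?L \<and> ?L ! i = 0}"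
      then show "i \<in> {..<p}" using pos_after[of i] by (cases "p \<le> i") auto
    qed
    then have "card {i. i < length ?L \<and> ?L ! i = 0} \<le> p"
      using card_mono[of "{..<p}"] by fastforce
    moreover have "count (mset ?L) 0 = card {i. i < length ?L \<and> ?L ! i = 0}"
      by (simp only: count_mset count_list_eq_length_filter length_filter_conv_card eq_commute[of 0])
    moreover have "count (image_mset (($) \<Lambda>) (mset_set UNIV)) 0 = card {k. \<Lambda> $ k = 0}"
      by (simp add: count_image_mset vimage_def)
    ultimately show False using ms K \<open>\<not> K \<le> p\<close> by simp
  qed
  then show ?thesis
    using sorted_nth_mono[OF srt, of K p] p by (simp add: eigenvalue_nth_def)
qed

section \<open>Laplacians and connected components\<close>

lemma edge_commute: "edge i j = edge j i"
  by (simp add: edge_def insert_commute)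

lemma adjacency_nth: "adjacency x $ i $ j = (if i = j then 0 else x $ edge i j)"
  by (simp add: adjacency_def)

lemma adjacency_commute: "adjacency x $ i $ j = adjacency x $ j $ i"
  by (simp add: adjacency_nth edge_commute)

lemma laplacian_mult_nth:
  "(laplacian x *v u) $ i = (\<Sum>j\<in>UNIV. adjacency x $ i $ j * (u $ i - u $ j))"
proof -
  have "(diag w *v u) $ i = w $ i * u $ i" for w
    by (simp add: matrix_vector_mult_def diag_def if_distrib if_distribR cong: if_cong)
  then show ?thesis
    by (simp add: laplacian_def matrix_vector_mult_diff_rdistrib)
      (simp add: matrix_vector_mult_def right_diff_distrib sum_subtractf sum_distrib_right)
qed

lemma transpose_laplacian: "transpose (laplacian x) = laplacian x"
  by (simp add: vec_eq_iff transpose_def laplacian_def diag_def adjacency_commute)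

lemma laplacian_diff_mult: "laplacian (x - y) *v u = laplacian x *v u - laplacian y *v u"
  by (simp add: vec_eq_iff laplacian_mult_nth adjacency_nth sum_subtractf[symmetric]
      left_diff_distrib[symmetric] if_distrib if_distribR)
    (intro allI sum.cong refl, simp add: algebra_simps)

lemma laplacian_quadratic_form:
  "u \<bullet> (laplacian x *v u) = 1/2 * (\<Sum>i\<in>UNIV. \<Sum>j\<in>UNIV. adjacency x $ i $ j * (u $ i - u $ j)\<^sup>2)"
proof -
  define S where "S = (\<Sum>i\<in>UNIV. \<Sum>j\<in>UNIV. adjacency x $ i $ j * (u $ i - u $ j) * u $ i)"
  have 1: "u \<bullet> (laplacian x *v u) = S"
    by (simp add: inner_vec_def laplacian_mult_nth S_def sum_distrib_left mult_ac)
  have "S = (\<Sum>i\<in>UNIV. \<Sum>j\<in>UNIV. adjacency x $ j $ i * (u $ j - u $ i) * u $ j)"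
    unfolding S_def by (rule sum.swap)
  also have "\<dots> = (\<Sum>i\<in>UNIV. \<Sum>j\<in>UNIV. adjacency x $ i $ j * (u $ j - u $ i) * u $ j)"
    by (simp add: adjacency_commute[of x])
  finally have "2 * S = (\<Sum>i\<in>UNIV. \<Sum>j\<in>UNIV. adjacency x $ i $ j * (u $ i - u $ j) * u $ i
      + adjacency x $ i $ j * (u $ j - u $ i) * u $ j)"
    by (simp add: sum.distrib S_def)
  also have "\<dots> = (\<Sum>i\<in>UNIV. \<Sum>j\<in>UNIV. adjacency x $ i $ j * (u $ i - u $ j)\<^sup>2)"
    by (intro sum.cong refl) (simp add: power2_eq_square algebra_simps)
  finally show ?thesis using 1 by simp
qed

lemma abs_vec_nth: "\<bar>x\<bar> $ e = \<bar>x $ e\<bar>" for x :: "real^'n"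
  by (simp add: abs_vec_def)

lemma adjacency_abs_nonneg: "0 \<le> adjacency \<bar>x\<bar> $ i $ j"
  by (simp add: adjacency_nth abs_vec_nth)

lemma laplacian_abs_psd: "0 \<le> u \<bullet> (laplacian \<bar>x\<bar> *v u)"
  unfolding laplacian_quadratic_form
  by (intro mult_nonneg_nonneg sum_nonneg) (auto simp: adjacency_abs_nonneg)

lemma laplacian_abs_eigenvalue_nonneg:
  assumes "eigenbasis (laplacian \<bar>x\<bar>) V \<Lambda>"
  shows "0 \<le> \<Lambda> $ k"
  using laplacian_abs_psd[of "column k V" x] eigenbasis_eigenvector[OF assms, of k]
    eigenbasis_orthonormal[OF assms, of k k] by simp

lemma equiv_connectivity: "equiv UNIV (connectivity x)"
proof -
  have "sym (connectivity x)"
    unfolding connectivity_def by (intro sym_rtrancl) (auto simp: sym_def edge_commute)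
  moreover have "refl (connectivity x)" "trans (connectivity x)"
    unfolding connectivity_def by (auto simp: refl_rtrancl trans_rtrancl)
  ultimately show ?thesis by (simp add: equiv_def)
qed

lemma connectivity_sym: "(i, j) \<in> connectivity x \<Longrightarrow> (j, i) \<in> connectivity x"
  using equiv_connectivity[of x] by (auto simp: equiv_def sym_def)

lemma connectivity_refl: "(i, i) \<in> connectivity x"
  by (simp add: connectivity_def)

lemma connectivity_trans:
  "(i, j) \<in> connectivity x \<Longrightarrow> (j, k) \<in> connectivity x \<Longrightarrow> (i, k) \<in> connectivity x"
  using equiv_connectivity[of x] by (auto simp: equiv_def trans_def)

lemma edge_in_within_pairs:
  assumes "i \<noteq> j"
  shows "edge i j \<in> within_pairs x \<longleftrightarrow> (i, j) \<in> connectivity x"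
  using assms by (auto simp: within_pairs_def edge_eq_iff intro: connectivity_sym)

lemma zero_outside_within_pairs:
  assumes "e \<notin> within_pairs x"
  shows "x $ e = 0"
proof -
  obtain i j where "i \<noteq> j" "e = edge i j" by (rule edge_exhaust)
  with assms show ?thesis by (auto simp: edge_in_within_pairs connectivity_def)
qed

definition component :: "real ^ ('d::card2) edge \<Rightarrow> 'd::card2 \<Rightarrow> 'd set" where
  "component x i = connectivity x `` {i}"

lemma mem_component: "j \<in> component x i \<longleftrightarrow> (i, j) \<in> connectivity x"
  by (simp add: component_def)

lemma finite_graph_components: "finite (graph_components x)"
  by (rule finite)

lemma component_in_graph_components: "component x i \<in> graph_components x"
  by (simp add: graph_components_def component_def quotientI)

lemma card_component_le: "card (component x i) \<le> max_component_size x"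
  unfolding max_component_size_def
  by (intro Max_ge finite_imageI finite_graph_components imageI component_in_graph_components)

lemma card_component_pos: "0 < card (component x i)"
  using connectivity_refl[of i x] by (auto simp: card_gt_0_iff mem_component)

lemma component_eq: "(i, j) \<in> connectivity x \<Longrightarrow> component x i = component x j"
  by (auto simp: mem_component intro: connectivity_trans connectivity_sym
      connectivity_trans[OF connectivity_sym])

lemma two_le_max_component_size:
  assumes "x \<noteq> 0"
  shows "2 \<le> max_component_size x"
proof -
  obtain e where e: "x $ e \<noteq> 0" using assms by (auto simp: vec_eq_iff)
  obtain i j where ij: "i \<noteq> j" "e = edge i j" by (rule edge_exhaust)
  then have "(i, j) \<in> connectivity x" using e by (auto simp: connectivity_def)
  then have "{i, j} \<subseteq> component x i" by (auto simp: mem_component connectivity_refl)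
  then have "card {i, j} \<le> card (component x i)" by (intro card_mono) auto
  with ij card_component_le[of x i] show ?thesis by simp
qed

definition block_constant :: "real ^ ('d::card2) edge \<Rightarrow> (real ^ 'd::card2) set" where
  "block_constant x = {u. \<forall>i j. (i, j) \<in> connectivity x \<longrightarrow> u $ i = u $ j}"

lemma laplacian_kernel:
  "laplacian \<bar>x\<bar> *v u = 0 \<longleftrightarrow> u \<in> block_constant x"
proof
  assume "laplacian \<bar>x\<bar> *v u = 0"
  then have "(\<Sum>i\<in>UNIV. \<Sum>j\<in>UNIV. adjacency \<bar>x\<bar> $ i $ j * (u $ i - u $ j)\<^sup>2) = 0"
    using laplacian_quadratic_form[of u "\<bar>x\<bar>"] by simp
  then have z: "adjacency \<bar>x\<bar> $ i $ j * (u $ i - u $ j)\<^sup>2 = 0" for i j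
    by (subst (asm) sum_nonneg_eq_0_iff; (subst (asm) sum_nonneg_eq_0_iff)?)
      (auto simp: adjacency_abs_nonneg intro!: sum_nonneg)
  have "u $ i = u $ j" if "(i, j) \<in> connectivity x" for i j
    using that unfolding connectivity_def
  proof (induction rule: rtrancl_induct)
    case (step k l)
    then show ?case using z[of k l] by (simp add: adjacency_nth abs_vec_nth)
  qed simp
  then show "u \<in> block_constant x" by (simp add: block_constant_def)
next
  assume u: "u \<in> block_constant x"
  have "adjacency \<bar>x\<bar> $ i $ j * (u $ i - u $ j) = 0" for i j
  proof (cases "adjacency \<bar>x\<bar> $ i $ j = 0")
    case False
    then have "(i, j) \<in> connectivity x"
      by (auto simp: adjacency_nth abs_vec_nth connectivity_def split: if_splits)
    then show ?thesis using u by (simp add: block_constant_def)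
  qed simp
  then show "laplacian \<bar>x\<bar> *v u = 0" unfolding vec_eq_iff laplacian_mult_nth zero_index by (intro allI sum.neutral) auto
qed

lemma component_indicator_block_constant:
  "(\<chi> k. if k \<in> component x i then c else 0) \<in> block_constant x"
  by (auto simp: block_constant_def mem_component intro: connectivity_trans connectivity_sym)

text \<open>
  The indicator vectors of the components are independent and lie in the kernel, which is spanned by
  the eigenvectors for the eigenvalue \<open>0\<close>.
\<close>

lemma card_graph_components_le:
  assumes eb: "eigenbasis (laplacian \<bar>x\<bar>) V \<Lambda>"
  shows "card (graph_components x) \<le> card {k. \<Lambda> $ k = 0}"
proof -
  let ?h = "\<lambda>C. (\<chi> k. if k \<in> C then 1 else 0) :: real^'a::card2"
  let ?Z = "{k. \<Lambda> $ k = 0}"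
  let ?B = "?h ` graph_components x"
  have comp: "\<exists>i. C = component x i" if "C \<in> graph_components x" for C
    using that by (auto simp: graph_components_def component_def quotient_def)
  have inj: "inj_on ?h (graph_components x)"
  proof (intro inj_onI set_eqI)
    fix C D and k :: 'a assume "?h C = ?h D"
    then have "?h C $ k = ?h D $ k" by (simp only:)
    then show "k \<in> C \<longleftrightarrow> k \<in> D" by (simp split: if_splits)
  qed
  have orth: "pairwise orthogonal ?B"
  proof (intro pairwiseI)
    fix a b assume "a \<in> ?B" "b \<in> ?B" "a \<noteq> b"
    then obtain C D where CD: "a = ?h C" "b = ?h D" "C \<in> graph_components x" "D \<in> graph_components x" "C \<noteq> D"
      by blast
    then have "C \<inter> D = {}"
      using quotient_disj[OF equiv_connectivity] by (auto simp: graph_components_def)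
    then show "orthogonal a b" unfolding orthogonal_def inner_vec_def CD
      by (intro sum.neutral) auto
  qed
  have "0 \<notin> ?B"
  proof
    assume "0 \<in> ?B"
    then obtain C where C: "C \<in> graph_components x" "?h C = 0" by force
    obtain i where "C = component x i" using comp C(1) by blast
    then have "?h C $ i = 1" by (simp add: mem_component connectivity_refl)
    with C(2) show False by simp
  qed
  then have ind: "independent ?B" by (rule pairwise_orthogonal_independent[OF orth])
  have "?B \<subseteq> span ((\<lambda>k. column k V) ` ?Z)"
  proof
    fix u assume "u \<in> ?B"
    then have "u \<in> block_constant x" using comp component_indicator_block_constant[of x _ 1] by fastforce
    then have ker: "laplacian \<bar>x\<bar> *v u = 0" by (simp add: laplacian_kernel)
    have coord: "column k V \<bullet> u = 0" if "k \<notin> ?Z" for k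
      using eigenbasis_coord_mult[OF eb transpose_laplacian, of k u] ker that by simp
    have "u = (\<Sum>k\<in>UNIV. (column k V \<bullet> u) *\<^sub>R column k V)"
    proof (rule vector_eq_ldot[THEN iffD1], rule allI)
      fix y
      show "y \<bullet> u = y \<bullet> (\<Sum>k\<in>UNIV. (column k V \<bullet> u) *\<^sub>R column k V)"
        using eigenbasis_parseval[OF eb, of u y] by (simp add: inner_sum_right inner_commute)
    qed
    also have "\<dots> = (\<Sum>k\<in>?Z. (column k V \<bullet> u) *\<^sub>R column k V)"
      using coord by (intro sum.mono_neutral_right) auto
    also have "\<dots> \<in> span ((\<lambda>k. column k V) ` ?Z)"
      by (intro span_sum span_scale span_base) auto
    finally show "u \<in> span ((\<lambda>k. column k V) ` ?Z)" .
  qed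
  from independent_span_bound[OF _ ind this]
  have "card ?B \<le> card ((\<lambda>k. column k V) ` ?Z)" by simp
  also have "\<dots> \<le> card ?Z" by (rule card_image_le) simp
  finally show ?thesis by (simp add: card_image[OF inj])
qed

lemma laplacian_spectral_gap:
  assumes eb: "eigenbasis (laplacian \<bar>x\<bar>) V \<Lambda>"
    and gap: "\<Delta> \<le> eigenvalue_nth (card (graph_components x) + 1) (laplacian \<bar>x\<bar>)"
    and "\<Lambda> $ k \<noteq> 0"
  shows "\<Delta> \<le> \<Lambda> $ k"
  using gap eigenvalue_nth_Suc_le[OF eb laplacian_abs_eigenvalue_nonneg[OF eb]
      card_graph_components_le[OF eb] assms(3)] by linarith

text \<open>
  This is the orthogonal projection of \<open>axis i 1\<close> onto the block-constant vectors, as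
  \<open>inner_block_average\<close> confirms.
\<close>

definition block_average :: "real ^ ('d::card2) edge \<Rightarrow> 'd::card2 \<Rightarrow> real ^ 'd::card2" where
  "block_average x i = (\<chi> k. if k \<in> component x i then 1 / real (card (component x i)) else 0)"

lemma block_average_block_constant: "block_average x i \<in> block_constant x"
  unfolding block_average_def by (rule component_indicator_block_constant)

lemma inner_block_average:
  assumes "u \<in> block_constant x"
  shows "u \<bullet> block_average x i = u $ i"
proof -
  have "u \<bullet> block_average x i = (\<Sum>k\<in>component x i. u $ k / real (card (component x i)))"
    unfolding inner_vec_def block_average_def
    by (simp add: if_distrib if_distribR sum.If_cases cong: if_cong)
  also have "\<dots> = (\<Sum>k\<in>component x i. u $ i / real (card (component x i)))"
    using assms by (intro sum.cong) (auto simp: block_constant_def mem_component)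
  also have "\<dots> = u $ i" using card_component_pos[of x i] by auto
  finally show ?thesis .
qed

lemma block_constant_diff: "u \<in> block_constant x \<Longrightarrow> w \<in> block_constant x \<Longrightarrow> u - w \<in> block_constant x"
  unfolding block_constant_def mem_Collect_eq vector_minus_component by metis

lemma block_average_eq: "(i, j) \<in> connectivity x \<Longrightarrow> block_average x i = block_average x j"
  by (simp add: block_average_def component_eq[of i j] cong: if_cong)

text \<open>
  The two averages have disjoint supports, so their squared norms, the inverses of the two component
  sizes, add up.
\<close>

lemma norm_block_average_diff:
  assumes "(i, j) \<notin> connectivity x"
  shows "2 / real (max_component_size x) \<le> (norm (block_average x i - block_average x j))\<^sup>2"
proof -
  let ?u = "block_average x i - block_average x j"
  have "(norm ?u)\<^sup>2 = ?u $ i - ?u $ j"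
    unfolding power2_norm_eq_inner
    by (subst inner_diff_right) (simp add: inner_block_average block_constant_diff block_average_block_constant)
  also have "\<dots> = 1 / real (card (component x i)) + 1 / real (card (component x j))"
    using assms connectivity_sym[of j i x] card_component_pos[of x j]
    by (auto simp: block_average_def mem_component connectivity_refl)
  also have "\<dots> \<ge> 1 / real (max_component_size x) + 1 / real (max_component_size x)"
    using card_component_le[of x] card_component_pos[of x]
    by (intro add_mono divide_left_mono mult_pos_pos)
      (auto simp: order_less_le_trans[OF card_component_pos[of x i] card_component_le])
  finally show ?thesis by simp
qed

section \<open>Perturbation of eigenvectors\<close>

lemma eigenbasis_coordinates_exist:
  assumes "eigenbasis A V \<Lambda>"
  obtains q where "\<And>k. column k V \<bullet> q = c k"
proof
  show "column k V \<bullet> (\<Sum>l\<in>UNIV. c l *\<^sub>R column l V) = c k" for k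
    by (simp add: inner_sum_right eigenbasis_orthonormal[OF assms] if_distrib cong: if_cong)
qed

lemma eigenbasis_norm_mult:
  assumes "eigenbasis A V \<Lambda>" "transpose A = A"
  shows "(norm (A *v x))\<^sup>2 = (\<Sum>k\<in>UNIV. (\<Lambda> $ k)\<^sup>2 * (column k V \<bullet> x)\<^sup>2)"
  by (simp add: eigenbasis_norm[OF assms(1)] eigenbasis_coord_mult[OF assms] power_mult_distrib)

lemma eigenbasis_quadratic_form:
  assumes "eigenbasis A V \<Lambda>" "transpose A = A"
  shows "x \<bullet> (A *v x) = (\<Sum>k\<in>UNIV. \<Lambda> $ k * (column k V \<bullet> x)\<^sup>2)"
  unfolding eigenbasis_parseval[OF assms(1), of x "A *v x"]
  by (simp add: eigenbasis_coord_mult[OF assms] power2_eq_square mult_ac)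

lemma norm_column_eigenbasis: "eigenbasis A V \<Lambda> \<Longrightarrow> norm (column k V) = 1"
  by (simp add: norm_eq_1 eigenbasis_orthonormal)

text \<open>
  An eigenvector of \<open>A\<close> for \<open>\<lambda>\<close> satisfies \<open>norm (B *v v - \<lambda> *\<^sub>R v) \<le> \<epsilon> * norm v\<close>, and the left-hand side
  is at least the distance from \<open>\<lambda>\<close> to the spectrum of \<open>B\<close> times \<open>norm v\<close>. That spectrum has a
  gap between \<open>0\<close> and \<open>\<Delta>\<close>, which places each eigenvalue of \<open>A\<close> near \<open>0\<close> or near or above \<open>\<Delta>\<close>.
\<close>

lemma eigenvalue_separation:
  assumes A: "eigenbasis A V \<Lambda>" "transpose A = A" and B: "eigenbasis B W \<Omega>" "transpose B = B"
    and gap: "\<And>j. \<Omega> $ j \<noteq> 0 \<Longrightarrow> \<Delta> \<le> \<Omega> $ j"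
    and pert: "\<And>x. norm (A *v x - B *v x) \<le> \<epsilon> * norm x" and "0 \<le> \<Lambda> $ k"
  shows "\<Lambda> $ k \<le> \<epsilon> \<or> \<Delta> - \<epsilon> \<le> \<Lambda> $ k"
proof (rule ccontr)
  assume neg: "\<not> ?thesis"
  define v where "v = column k V"
  define m where "m = min (\<Lambda> $ k) (\<Delta> - \<Lambda> $ k)"
  have nv: "norm v = 1" unfolding v_def by (rule norm_column_eigenbasis[OF A(1)])
  have "0 \<le> \<epsilon>" using order_trans[OF norm_ge_zero pert[of v]] nv by simp
  with neg have m: "\<epsilon> < m" "0 \<le> m" by (auto simp: m_def)
  have "norm (A *v v - B *v v) \<le> \<epsilon>" using pert[of v] nv by simp
  then have "norm (B *v v - \<Lambda> $ k *\<^sub>R v) \<le> \<epsilon>"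
    using eigenbasis_eigenvector[OF A(1), of k] by (simp add: v_def norm_minus_commute)
  then have "(norm (B *v v - \<Lambda> $ k *\<^sub>R v))\<^sup>2 \<le> \<epsilon>\<^sup>2" by (simp add: power_mono)
  moreover have "(norm (B *v v - \<Lambda> $ k *\<^sub>R v))\<^sup>2 = (\<Sum>j\<in>UNIV. (\<Omega> $ j - \<Lambda> $ k)\<^sup>2 * (column j W \<bullet> v)\<^sup>2)"
    unfolding eigenbasis_norm[OF B(1), of "B *v v - \<Lambda> $ k *\<^sub>R v"] inner_diff_right
      eigenbasis_coord_mult[OF B] inner_scaleR_right
    by (simp add: left_diff_distrib[symmetric] power_mult_distrib)
  moreover have "(\<Sum>j\<in>UNIV. (\<Omega> $ j - \<Lambda> $ k)\<^sup>2 * (column j W \<bullet> v)\<^sup>2) \<ge> (\<Sum>j\<in>UNIV. m\<^sup>2 * (column j W \<bullet> v)\<^sup>2)"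
  proof (intro sum_mono mult_right_mono)
    fix j
    have "m \<le> \<bar>\<Omega> $ j - \<Lambda> $ k\<bar>" using gap[of j] by (cases "\<Omega> $ j = 0") (auto simp: m_def)
    then show "m\<^sup>2 \<le> (\<Omega> $ j - \<Lambda> $ k)\<^sup>2" using m power_mono[of m "\<bar>\<Omega> $ j - \<Lambda> $ k\<bar>" 2] by simp
  qed simp
  moreover have "(\<Sum>j\<in>UNIV. m\<^sup>2 * (column j W \<bullet> v)\<^sup>2) = m\<^sup>2"
    using nv eigenbasis_norm[OF B(1), of v] by (simp add: sum_distrib_left[symmetric])
  ultimately have "m\<^sup>2 \<le> \<epsilon>\<^sup>2" by simp
  then have "m \<le> \<epsilon>" using \<open>0 \<le> \<epsilon>\<close> by (rule power2_le_imp_le)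
  with m show False by simp
qed

text \<open>
  On the kernel of \<open>B\<close> the matrix \<open>A\<close> acts by the perturbation alone, while it stretches the
  coordinates in \<open>H\<close> by \<open>\<eta>\<close> or more.
\<close>

lemma kernel_vector_high_part:
  assumes A: "eigenbasis A V \<Lambda>" "transpose A = A"
    and pert: "\<And>x. norm (A *v x - B *v x) \<le> \<epsilon> * norm x" and u: "B *v u = 0"
    and "0 < \<eta>" and high: "\<And>k. k \<in> H \<Longrightarrow> \<eta> \<le> \<Lambda> $ k"
  shows "L2_set (\<lambda>k. column k V \<bullet> u) H \<le> \<epsilon> / \<eta> * norm u"
proof -
  have "(\<eta> * L2_set (\<lambda>k. column k V \<bullet> u) H)\<^sup>2 = (\<Sum>k\<in>H. \<eta>\<^sup>2 * (column k V \<bullet> u)\<^sup>2)"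
    by (simp add: L2_set_def power_mult_distrib sum_nonneg sum_distrib_left)
  also have "\<dots> \<le> (\<Sum>k\<in>H. (\<Lambda> $ k)\<^sup>2 * (column k V \<bullet> u)\<^sup>2)"
    using high \<open>0 < \<eta>\<close> by (intro sum_mono mult_right_mono power_mono) auto
  also have "\<dots> \<le> (norm (A *v u))\<^sup>2"
    unfolding eigenbasis_norm_mult[OF A] by (intro sum_mono2) auto
  finally have "\<eta> * L2_set (\<lambda>k. column k V \<bullet> u) H \<le> norm (A *v u)"
    by (rule power2_le_imp_le) simp
  also have "\<dots> \<le> \<epsilon> * norm u" using pert[of u] u by simp
  finally show ?thesis using \<open>0 < \<eta>\<close> by (simp add: field_simps)
qed

text \<open>
  A bound of Davis-Kahan type. A vector \<open>w\<close> orthogonal to the kernel is \<open>B *v q\<close> with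
  \<open>norm q \<le> norm w / \<Delta>\<close>. If \<open>p\<close> is the low part of \<open>w\<close>, then
  \<open>(norm p)\<^sup>2 = p \<bullet> w = (B *v p) \<bullet> q\<close>, and \<open>B *v p\<close> is small because both \<open>A *v p\<close> and the perturbation
  are at most \<open>\<epsilon> * norm p\<close>.
\<close>

lemma kernel_complement_low_part:
  assumes A: "eigenbasis A V \<Lambda>" "transpose A = A" and B: "eigenbasis B W \<Omega>" "transpose B = B"
    and gap: "\<And>j. \<Omega> $ j \<noteq> 0 \<Longrightarrow> \<Delta> \<le> \<Omega> $ j" and "0 < \<Delta>"
    and pert: "\<And>x. norm (A *v x - B *v x) \<le> \<epsilon> * norm x" and "0 \<le> \<epsilon>"
    and low: "\<And>k. k \<in> L \<Longrightarrow> \<bar>\<Lambda> $ k\<bar> \<le> \<epsilon>"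
    and w: "\<And>u. B *v u = 0 \<Longrightarrow> u \<bullet> w = 0"
  shows "L2_set (\<lambda>k. column k V \<bullet> w) L \<le> 2 * \<epsilon> / \<Delta> * norm w"
proof -
  obtain q where q: "\<And>j. column j W \<bullet> q = (column j W \<bullet> w) / \<Omega> $ j"
    by (rule eigenbasis_coordinates_exist[OF B(1), where c = "\<lambda>j. (column j W \<bullet> w) / \<Omega> $ j"]) blast
  obtain p where p: "\<And>k. column k V \<bullet> p = (if k \<in> L then column k V \<bullet> w else 0)"
    by (rule eigenbasis_coordinates_exist[OF A(1), where c = "\<lambda>k. if k \<in> L then column k V \<bullet> w else 0"]) blast
  have w0: "column j W \<bullet> w = 0" if "\<Omega> $ j = 0" for j
    using w[of "column j W"] eigenbasis_eigenvector[OF B(1), of j] that by simp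
  have Bq: "B *v q = w"
  proof (rule vector_eq_ldot[THEN iffD1], rule allI)
    fix y
    have "column j W \<bullet> (B *v q) = column j W \<bullet> w" for j
      using w0[of j] by (simp add: eigenbasis_coord_mult[OF B] q)
    then show "y \<bullet> (B *v q) = y \<bullet> w" by (simp add: eigenbasis_parseval[OF B(1), of y])
  qed
  have "(\<Delta> * norm q)\<^sup>2 = (\<Sum>j\<in>UNIV. \<Delta>\<^sup>2 * (column j W \<bullet> q)\<^sup>2)"
    by (simp add: power_mult_distrib eigenbasis_norm[OF B(1), of q] sum_distrib_left)
  also have "\<dots> \<le> (\<Sum>j\<in>UNIV. (\<Omega> $ j)\<^sup>2 * (column j W \<bullet> q)\<^sup>2)"
  proof (rule sum_mono)
    fix j show "\<Delta>\<^sup>2 * (column j W \<bullet> q)\<^sup>2 \<le> (\<Omega> $ j)\<^sup>2 * (column j W \<bullet> q)\<^sup>2"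
      using gap[of j] \<open>0 < \<Delta>\<close> q[of j] by (cases "\<Omega> $ j = 0") (auto intro!: mult_right_mono power_mono)
  qed
  also have "\<dots> = (norm w)\<^sup>2" using eigenbasis_norm_mult[OF B, of q] Bq by simp
  finally have nq: "\<Delta> * norm q \<le> norm w" by (rule power2_le_imp_le) simp
  define s where "s = L2_set (\<lambda>k. column k V \<bullet> w) L"
  have s0: "0 \<le> s" by (simp add: s_def)
  have s2: "s\<^sup>2 = (\<Sum>k\<in>L. (column k V \<bullet> w)\<^sup>2)" by (simp add: s_def L2_set_def sum_nonneg)
  have UL: "(\<Sum>k\<in>UNIV. if k \<in> L then f k else 0) = (\<Sum>k\<in>L. f k)" for f :: "'a \<Rightarrow> real"
    by (simp add: sum.If_cases)
  have "(norm p)\<^sup>2 = s\<^sup>2"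
    unfolding eigenbasis_norm[OF A(1), of p] p s2 UL[symmetric] by (intro sum.cong) auto
  then have np: "norm p = s" using s0 by simp
  have pw: "p \<bullet> w = s\<^sup>2"
    unfolding eigenbasis_parseval[OF A(1), of p w] p s2 UL[symmetric]
    by (intro sum.cong) (auto simp: power2_eq_square)
  have "(norm (A *v p))\<^sup>2 \<le> (\<Sum>k\<in>UNIV. \<epsilon>\<^sup>2 * (column k V \<bullet> p)\<^sup>2)"
    unfolding eigenbasis_norm_mult[OF A]
  proof (rule sum_mono)
    fix k show "(\<Lambda> $ k)\<^sup>2 * (column k V \<bullet> p)\<^sup>2 \<le> \<epsilon>\<^sup>2 * (column k V \<bullet> p)\<^sup>2"
      using low[of k] power_mono[of "\<bar>\<Lambda> $ k\<bar>" \<epsilon> 2]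
      by (cases "k \<in> L") (auto simp: p intro!: mult_right_mono)
  qed
  also have "\<dots> = (\<epsilon> * s)\<^sup>2"
    using eigenbasis_norm[OF A(1), of p] np by (simp add: sum_distrib_left[symmetric] power_mult_distrib)
  finally have "norm (A *v p) \<le> \<epsilon> * s" 
    by (rule power2_le_imp_le) (simp add: \<open>0 \<le> \<epsilon>\<close> s0)
  moreover have "norm (B *v p) \<le> norm (A *v p) + norm (A *v p - B *v p)"
    using norm_triangle_ineq4[of "A *v p" "A *v p - B *v p"] by simp
  ultimately have Bp: "norm (B *v p) \<le> 2 * \<epsilon> * s" using pert[of p] np by simp
  have "s\<^sup>2 = (B *v p) \<bullet> q" using self_adjointD[OF B(2), of p q] pw Bq by simp
  also have "\<dots> \<le> norm (B *v p) * norm q" by (rule norm_cauchy_schwarz)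
  also have "\<dots> \<le> (2 * \<epsilon> * s) * (norm w / \<Delta>)"
    using Bp nq \<open>0 < \<Delta>\<close> \<open>0 \<le> \<epsilon>\<close> s0 by (intro mult_mono) (auto simp: field_simps)
  finally have "s * s \<le> s * (2 * \<epsilon> / \<Delta> * norm w)" by (simp add: power2_eq_square mult_ac)
  then have "s \<le> 2 * \<epsilon> / \<Delta> * norm w" if "0 < s"
    using that by (simp only: mult_le_cancel_left_pos)
  then have "s \<le> 2 * \<epsilon> / \<Delta> * norm w"
    using s0 \<open>0 \<le> \<epsilon>\<close> \<open>0 < \<Delta>\<close> by (cases "s = 0") auto
  then show ?thesis by (simp only: s_def)
qed

lemma kernel_complement_quadratic_bound:
  assumes B: "eigenbasis B W \<Omega>" "transpose B = B"
    and gap: "\<And>j. \<Omega> $ j \<noteq> 0 \<Longrightarrow> \<Delta> \<le> \<Omega> $ j"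
    and w: "\<And>u. B *v u = 0 \<Longrightarrow> u \<bullet> w = 0"
  shows "\<Delta> * (norm w)\<^sup>2 \<le> w \<bullet> (B *v w)"
proof -
  have w0: "column j W \<bullet> w = 0" if "\<Omega> $ j = 0" for j
    using w[of "column j W"] eigenbasis_eigenvector[OF B(1), of j] that by simp
  show ?thesis
    unfolding eigenbasis_quadratic_form[OF B] eigenbasis_norm[OF B(1), of w] sum_distrib_left
  proof (rule sum_mono)
    fix j show "\<Delta> * (column j W \<bullet> w)\<^sup>2 \<le> \<Omega> $ j * (column j W \<bullet> w)\<^sup>2"
      using gap[of j] w0[of j] by (cases "\<Omega> $ j = 0") (auto intro!: mult_right_mono)
  qed
qed

text \<open>
  On the orthogonal complement of the kernel of \<open>B\<close> the quadratic form of \<open>A\<close> is at least \<open>\<Delta> - \<epsilon>\<close>.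
  Since \<open>A\<close> vanishes on that kernel, this bound reaches all its nonzero eigenvalues, and the two
  kernels coincide.
\<close>

lemma same_kernel_eigenvalue_gap:
  assumes A: "eigenbasis A V \<Lambda>" "transpose A = A" and B: "eigenbasis B W \<Omega>" "transpose B = B"
    and gap: "\<And>j. \<Omega> $ j \<noteq> 0 \<Longrightarrow> \<Delta> \<le> \<Omega> $ j"
    and ker: "\<And>u. B *v u = 0 \<Longrightarrow> A *v u = 0"
    and pert: "\<And>x. x \<bullet> (B *v x) - \<epsilon> * (norm x)\<^sup>2 \<le> x \<bullet> (A *v x)" and "\<epsilon> < \<Delta>"
  shows "\<Lambda> $ k \<noteq> 0 \<Longrightarrow> \<Delta> - \<epsilon> \<le> \<Lambda> $ k"
    and "A *v x = 0 \<Longrightarrow> B *v x = 0"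
proof -
  have coercive: "(\<Delta> - \<epsilon>) * (norm w)\<^sup>2 \<le> w \<bullet> (A *v w)" if "\<And>u. B *v u = 0 \<Longrightarrow> u \<bullet> w = 0" for w
    using kernel_complement_quadratic_bound[OF B gap that] pert[of w] by (simp add: left_diff_distrib)
  {
    assume nz: "\<Lambda> $ k \<noteq> 0"
    have "u \<bullet> column k V = 0" if "B *v u = 0" for u
      using eigenbasis_coord_mult[OF A, of k u] ker[OF that] nz by (simp add: inner_commute)
    from coercive[OF this] show "\<Delta> - \<epsilon> \<le> \<Lambda> $ k"
      using norm_column_eigenbasis[OF A(1), of k] eigenbasis_orthonormal[OF A(1), of k k]
        eigenbasis_eigenvector[OF A(1), of k] by simp
  next
    assume Ax: "A *v x = 0"
    obtain w where w: "\<And>j. column j W \<bullet> w = (if \<Omega> $ j = 0 then 0 else column j W \<bullet> x)"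
      by (rule eigenbasis_coordinates_exist[OF B(1), where c = "\<lambda>j. if \<Omega> $ j = 0 then 0 else column j W \<bullet> x"]) blast
    have "(norm (B *v (x - w)))\<^sup>2 = 0"
      unfolding eigenbasis_norm_mult[OF B] inner_diff_right w by (intro sum.neutral) auto
    then have Bxw: "B *v (x - w) = 0" by simp
    have "u \<bullet> w = 0" if "B *v u = 0" for u
    proof -
      have "\<Omega> $ j * (column j W \<bullet> u) = 0" for j
        using eigenbasis_coord_mult[OF B, of j u] that by simp
      then show ?thesis
        unfolding eigenbasis_parseval[OF B(1), of u w] w by (intro sum.neutral) auto
    qed
    from coercive[OF this] have "(\<Delta> - \<epsilon>) * (norm w)\<^sup>2 \<le> w \<bullet> (A *v w)" .
    also have "A *v w = 0" using ker[OF Bxw] Ax by (simp add: matrix_vector_mult_diff_distrib)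
    finally have "(\<Delta> - \<epsilon>) * (norm w)\<^sup>2 \<le> 0" by simp
    then have "w = 0" using \<open>\<epsilon> < \<Delta>\<close> by (simp add: mult_le_0_iff)
    then show "B *v x = 0" using Bxw by simp
  }
qed

section \<open>The derivative of the penalty\<close>

lemma concave_deriv_antimono:
  fixes g :: "real \<Rightarrow> real"
  assumes conc: "concave_on {0..} g" and diff: "\<And>t. t > 0 \<Longrightarrow> g differentiable (at t)"
    and "0 < x" "x \<le> y"
  shows "deriv g y \<le> deriv g x"
proof (cases "x = y")
  case False
  with assms have xy: "x < y" by simp
  have conv: "convex_on {0..} (\<lambda>t. - g t)" using conc by (simp add: concave_on_def)
  have tangent: "- deriv g c * (t - c) \<le> - g t - - g c" if "0 < c" "0 \<le> t" for c t
  proof (rule convex_on_imp_above_tangent[OF conv])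
    have "DERIV g c :> deriv g c"
      using diff[OF that(1)] by (simp add: DERIV_deriv_iff_real_differentiable)
    then show "((\<lambda>t. - g t) has_field_derivative - deriv g c) (at c within {0..})"
      by (intro DERIV_subset[OF DERIV_minus]) auto
    show "c \<in> interior {0..}" using that by simp
  qed (use that in auto)
  have "0 \<le> (deriv g x - deriv g y) * (y - x)"
    using tangent[of x y] tangent[of y x] assms by (simp add: algebra_simps)
  then show ?thesis using xy by (simp add: zero_le_mult_iff)
qed simp

text \<open>
  A difference quotient near \<open>c\<close> is close to the derivative at \<open>c\<close> and, by the mean value theorem, is
  itself a value of the derivative at a nearby point. Such points exist on both sides of \<open>c\<close>, and
  monotonicity controls the derivative between them.
\<close>

lemma concave_deriv_isCont:
  fixes g :: "real \<Rightarrow> real"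
  assumes conc: "concave_on {0..} g" and diff: "\<And>t. t > 0 \<Longrightarrow> g differentiable (at t)"
    and c: "0 < c"
  shows "isCont (deriv g) c"
proof -
  have D: "DERIV g t :> deriv g t" if "t > 0" for t
    using diff[OF that] by (simp add: DERIV_deriv_iff_real_differentiable)
  show ?thesis unfolding continuous_at_eps_delta
  proof (intro allI impI)
    fix e :: real assume "0 < e"
    have "((\<lambda>x. (g x - g c) / (x - c)) \<longlongrightarrow> deriv g c) (at c)"
      using D[OF c] by (simp add: has_field_derivative_iff)
    then obtain \<delta> where \<delta>: "\<delta> > 0"
      "\<And>x. x \<noteq> c \<Longrightarrow> \<bar>x - c\<bar> < \<delta> \<Longrightarrow> \<bar>(g x - g c) / (x - c) - deriv g c\<bar> < e"
      using \<open>0 < e\<close> unfolding LIM_eq by (metis real_norm_def)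
    define r where "r = min \<delta> c / 2"
    have r: "0 < r" "r < \<delta>" "r < c" using \<delta>(1) c by (auto simp: r_def)
    obtain \<xi> where \<xi>: "c < \<xi>" "\<xi> < c + r" "g (c + r) - g c = (c + r - c) * deriv g \<xi>"
      using MVT2[of c "c + r" g "deriv g"] D c r(1) by force
    obtain \<zeta> where \<zeta>: "c - r < \<zeta>" "\<zeta> < c" "g c - g (c - r) = (c - (c - r)) * deriv g \<zeta>"
      using MVT2[of "c - r" c g "deriv g"] D r by force
    have "(g (c + r) - g c) / (c + r - c) = deriv g \<xi>" using \<xi>(3) r by simp
    then have e1: "\<bar>deriv g \<xi> - deriv g c\<bar> < e" using \<delta>(2)[of "c + r"] r by simp
    have "(g (c - r) - g c) / (c - r - c) = deriv g \<zeta>" using \<zeta>(3) r by (simp add: field_simps)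
    then have e2: "\<bar>deriv g \<zeta> - deriv g c\<bar> < e" using \<delta>(2)[of "c - r"] r by simp
    show "\<exists>d>0. \<forall>x'. dist x' c < d \<longrightarrow> dist (deriv g x') (deriv g c) < e"
    proof (intro exI[of _ "min (\<xi> - c) (c - \<zeta>)"] conjI allI impI)
      show "0 < min (\<xi> - c) (c - \<zeta>)" using \<xi> \<zeta> by simp
      fix s assume "dist s c < min (\<xi> - c) (c - \<zeta>)"
      then have "\<zeta> < s" "s < \<xi>" by (auto simp: dist_real_def)
      moreover have "0 < \<zeta>" using \<zeta> r by linarith
      ultimately have "deriv g \<xi> \<le> deriv g s" "deriv g s \<le> deriv g \<zeta>"
        by (auto intro!: concave_deriv_antimono[OF conc diff])
      with e1 e2 show "dist (deriv g s) (deriv g c) < e" by (auto simp: dist_real_def)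
    qed
  qed
qed

lemma scad_like_pen_deriv_continuous:
  assumes "scad_like a0 a1 b1 b2 \<tau> g"
  shows "continuous_on {0..} (pen_deriv g)"
proof -
  have conc: "concave_on {0..} g" and diff: "\<And>t. t > 0 \<Longrightarrow> g differentiable (at t)"
    and lim: "(deriv g \<longlongrightarrow> a0 * \<tau>) (at_right 0)"
    using assms by (auto simp: scad_like_def)
  have "(pen_deriv g \<longlongrightarrow> pen_deriv g t) (at t within {0..})" if "0 \<le> t" for t
  proof (cases "t = 0")
    case True
    have "\<forall>\<^sub>F x in at_right 0. deriv g x = pen_deriv g x"
      using eventually_at_right_less[of 0] by eventually_elim (auto simp: pen_deriv_def)
    then have "(pen_deriv g \<longlongrightarrow> a0 * \<tau>) (at_right 0)"
      using lim by (rule Lim_transform_eventually[rotated])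
    then show ?thesis using scad_like_pen_deriv_0[OF assms] True
      by (simp add: at_within_Ici_at_right)
  next
    case False
    with that have t: "t > 0" by simp
    have "(deriv g \<longlongrightarrow> deriv g t) (at t)"
      using concave_deriv_isCont[OF conc diff t] by (simp add: isCont_def)
    moreover have "\<forall>\<^sub>F x in at t. deriv g x = pen_deriv g x"
      using order_tendstoD(1)[OF tendsto_ident_at t] by eventually_elim (auto simp: pen_deriv_def)
    ultimately have "(pen_deriv g \<longlongrightarrow> deriv g t) (at t)"
      by (rule Lim_transform_eventually)
    then show ?thesis using t by (auto simp: pen_deriv_def intro: tendsto_within_subset)
  qed
  then show ?thesis by (simp add: continuous_on_def)
qed

lemma scad_like_pen_deriv_le:
  assumes "scad_like a0 a1 b1 b2 \<tau> g" "0 \<le> t"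
  shows "pen_deriv g t \<le> a0 * \<tau>"
proof (cases "t = 0")
  case True
  then show ?thesis using scad_like_pen_deriv_0[OF assms(1)] by simp
next
  case False
  with assms have t: "t > 0" by simp
  have "\<forall>\<^sub>F x in at_right 0. deriv g t \<le> deriv g x"
    unfolding eventually_at_right_field
    using t assms concave_deriv_antimono[of g _ t]
    by (intro exI[of _ t]) (auto simp: scad_like_def)
  then have "deriv g t \<le> a0 * \<tau>"
    using assms by (intro tendsto_lowerbound[of "deriv g" _ "at_right 0"]) (auto simp: scad_like_def)
  then show ?thesis using t by (simp add: pen_deriv_def)
qed

lemma scad_like_pen_deriv_nonneg:
  assumes "scad_like a0 a1 b1 b2 \<tau> g" "0 \<le> t"
  shows "0 \<le> pen_deriv g t"
proof -
  \<comment> \<open>The derivative decreases to the value \<open>0\<close> taken beyond \<open>b2 * \<tau>\<close>.\<close>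
  have *: "0 \<le> deriv g s" if "s > 0" for s
  proof -
    let ?m = "max s (b2 * \<tau>)"
    have "pen_deriv g ?m = 0" using assms(1) that by (auto simp: scad_like_def)
    then have "deriv g ?m = 0" using that by (simp add: pen_deriv_def split: if_splits)
    then show ?thesis
      using concave_deriv_antimono[of g s ?m] assms(1) that by (auto simp: scad_like_def)
  qed
  show ?thesis
  proof (cases "t = 0")
    case True
    have "\<forall>\<^sub>F x in at_right 0. 0 \<le> deriv g x"
      using eventually_at_right_less[of 0] by eventually_elim (rule *)
    then have "0 \<le> a0 * \<tau>"
      using assms by (intro tendsto_lowerbound[of "deriv g" _ "at_right 0"]) (auto simp: scad_like_def)
    then show ?thesis using True scad_like_pen_deriv_0[OF assms(1)] by simp
  next
    case False
    then show ?thesis using *[of t] assms by (simp add: pen_deriv_def)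
  qed
qed

lemma scad_like_pen_deriv_ge:
  assumes "scad_like a0 a1 b1 b2 \<tau> g" "0 \<le> t" "t \<le> b1 * \<tau>" "a1 \<le> a0" "0 \<le> \<tau>"
  shows "a1 * \<tau> \<le> pen_deriv g t"
proof (cases "t = 0")
  case True
  then show ?thesis using scad_like_pen_deriv_0[OF assms(1)] assms by (simp add: mult_right_mono)
next
  case False
  then show ?thesis using assms by (simp add: scad_like_def)
qed

section \<open>The LLA update as soft thresholding\<close>

text \<open>
  For \<open>m \<ge> 0\<close> this is \<open>sgn y * max 0 (\<bar>y\<bar> - m)\<close>; the form chosen here is visibly continuous in both
  arguments.
\<close>

definition soft_threshold :: "real \<Rightarrow> real \<Rightarrow> real" where
  "soft_threshold m y = max 0 (y - m) - max 0 (- y - m)"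

text \<open>
  The quadratic surplus on the left comes from strong convexity; it gives uniqueness of the
  minimizer along with minimality.
\<close>

lemma soft_threshold_strong_minimum:
  assumes "0 \<le> m"
  shows "1/2 * (y - soft_threshold m y)\<^sup>2 + m * \<bar>soft_threshold m y\<bar> + 1/2 * (t - soft_threshold m y)\<^sup>2
    \<le> 1/2 * (y - t)\<^sup>2 + m * \<bar>t\<bar>"
proof -
  have mt: "m * t \<le> m * \<bar>t\<bar>" "m * (-t) \<le> m * \<bar>t\<bar>"
    using assms by (intro mult_left_mono; simp)+
  consider "m < y" | "y < - m" | "\<bar>y\<bar> \<le> m" by linarith
  then show ?thesis
  proof cases
    case 1
    then have s: "soft_threshold m y = y - m" and a: "\<bar>y - m\<bar> = y - m"
      using assms by (auto simp: soft_threshold_def)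
    show ?thesis unfolding s a using mt by (simp add: power2_eq_square algebra_simps)
  next
    case 2
    then have s: "soft_threshold m y = y + m" and a: "\<bar>y + m\<bar> = - (y + m)"
      using assms by (auto simp: soft_threshold_def)
    show ?thesis unfolding s a using mt by (simp add: power2_eq_square algebra_simps)
  next
    case 3
    then have s: "soft_threshold m y = 0" by (simp add: soft_threshold_def)
    have "y * t \<le> \<bar>y\<bar> * \<bar>t\<bar>" by (metis abs_ge_self abs_mult)
    also have "\<dots> \<le> m * \<bar>t\<bar>" using 3 by (intro mult_right_mono) auto
    finally show ?thesis by (simp add: s power2_eq_square algebra_simps)
  qed
qed

lemma soft_threshold_eq_0: "\<bar>y\<bar> \<le> m \<Longrightarrow> soft_threshold m y = 0"
  by (simp add: soft_threshold_def)

lemma soft_threshold_0: "soft_threshold 0 y = y"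
  by (simp add: soft_threshold_def)

lemma soft_threshold_dist: "0 \<le> m \<Longrightarrow> \<bar>soft_threshold m y - y\<bar> \<le> m"
  by (auto simp: soft_threshold_def max_def)

definition lla_update ::
  "(real \<Rightarrow> real) \<Rightarrow> real ^ ('d::card2) edge \<Rightarrow> real ^ 'd::card2 ^ 'd::card2 \<Rightarrow> real ^ 'd::card2 \<Rightarrow> real ^ ('d::card2) edge" where
  "lla_update g y V \<Lambda> =
     (\<chi> e. soft_threshold (edge_weights V (\<chi> k. pen_deriv g (\<Lambda> $ k)) $ e / 2) (y $ e))"

lemma edge_weights_nonneg:
  assumes "\<And>k. 0 \<le> w $ k"
  shows "0 \<le> edge_weights V w $ e"
proof -
  obtain i j where "i \<noteq> j" "e = edge i j" by (rule edge_exhaust)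
  then show ?thesis using assms by (auto simp: edge_weights_nth intro!: sum_nonneg)
qed

lemma ls_loss_eq_sum: "ls_loss y \<beta> = (\<Sum>e\<in>UNIV. 1/2 * (y $ e - \<beta> $ e)\<^sup>2)"
  unfolding ls_loss_def power2_norm_eq_inner inner_vec_def
  by (simp add: sum_distrib_left power2_eq_square)

lemma is_arg_min_soft_threshold:
  assumes "\<And>e. 0 \<le> m $ e"
  shows "is_arg_min (\<lambda>\<beta>. ls_loss y \<beta> + 1/2 * (\<Sum>e\<in>UNIV. m $ e * \<bar>\<beta> $ e\<bar>)) (\<lambda>_. True) b
    \<longleftrightarrow> b = (\<chi> e. soft_threshold (m $ e / 2) (y $ e))"
proof -
  let ?F = "\<lambda>\<beta>. ls_loss y \<beta> + 1/2 * (\<Sum>e\<in>UNIV. m $ e * \<bar>\<beta> $ e\<bar>)"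
  let ?s = "\<chi> e. soft_threshold (m $ e / 2) (y $ e)"
  have F: "?F \<beta> = (\<Sum>e\<in>UNIV. 1/2 * (y $ e - \<beta> $ e)\<^sup>2 + m $ e / 2 * \<bar>\<beta> $ e\<bar>)" for \<beta>
    by (simp add: ls_loss_eq_sum sum.distrib sum_distrib_left)
  have strong: "?F ?s + ls_loss \<beta> ?s \<le> ?F \<beta>" for \<beta>
    unfolding F ls_loss_eq_sum[of \<beta>] sum.distrib[symmetric]
    using assms by (intro sum_mono order_trans[OF _ soft_threshold_strong_minimum]) (simp_all add: add_ac)
  have nn: "0 \<le> ls_loss \<beta> ?s" for \<beta> by (simp add: ls_loss_def)
  show ?thesis
  proof
    assume "is_arg_min ?F (\<lambda>_. True) b"
    then have "\<not> ?F ?s < ?F b" unfolding is_arg_min_def by blast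
    with strong[of b] nn[of b] have "ls_loss b ?s = 0" by linarith
    then show "b = ?s" by (simp add: ls_loss_def)
  next
    assume b: "b = ?s"
    show "is_arg_min ?F (\<lambda>_. True) b"
      unfolding is_arg_min_def b using strong nn by (smt (verit, best))
  qed
qed

lemma lla_step_iff:
  assumes "\<And>t. 0 \<le> t \<Longrightarrow> 0 \<le> pen_deriv g t"
  shows "lla_step (ls_loss y) g b b' \<longleftrightarrow>
    (\<exists>V \<Lambda>. eigenbasis (laplacian \<bar>b\<bar>) V \<Lambda> \<and> b' = lla_update g y V \<Lambda>)"
proof -
  have "is_arg_min (\<lambda>\<beta>. ls_loss y \<beta> +
      1/2 * (\<Sum>e\<in>UNIV. edge_weights V (\<chi> k. pen_deriv g (\<Lambda> $ k)) $ e * \<bar>\<beta> $ e\<bar>)) (\<lambda>_. True) b'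
    \<longleftrightarrow> b' = lla_update g y V \<Lambda>" if "eigenbasis (laplacian \<bar>b\<bar>) V \<Lambda>" for V \<Lambda>
    unfolding lla_update_def
    by (intro is_arg_min_soft_threshold edge_weights_nonneg)
      (simp add: assms laplacian_abs_eigenvalue_nonneg[OF that])
  then show ?thesis unfolding lla_step_def by blast
qed

text \<open>
  If every iterate has a successor, each finite run extends to an infinite one. The behaviour of
  all later iterates is then governed by two conditions on single steps: two steps from the start end
  at \<open>x\<close>, and \<open>x\<close> is its own only successor. This finite form makes the event measurable.
\<close>

lemma lla_converges_iff:
  assumes total: "\<And>b. \<exists>b'. lla_step l g b b'"
  shows "lla_converges_after_two_steps l g b0 x \<longleftrightarrow>
    (\<forall>b1 b2. lla_step l g b0 b1 \<longrightarrow> lla_step l g b1 b2 \<longrightarrow> b2 = x) \<and>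
    (\<forall>b'. lla_step l g x b' \<longrightarrow> b' = x)"
proof -
  have run: "\<exists>b. lla_run l g c b" for c
    using dependent_nat_choice[of "\<lambda>k b. k = 0 \<longrightarrow> b = c" "\<lambda>_. lla_step l g"] total
    unfolding lla_run_def by (metis nat.distinct(1))
  have cons: "lla_run l g c (case_nat c b)" if "lla_step l g c d" "lla_run l g d b" for c d b
    using that by (auto simp: lla_run_def split: nat.splits)
  show ?thesis
  proof
    assume conv: "lla_converges_after_two_steps l g b0 x"
    then have all: "b k = x" if "lla_run l g b0 b" "k \<ge> 2" for b k
      using that by (auto simp: lla_converges_after_two_steps_def)
    have 1: "b2 = x" if "lla_step l g b0 b1" "lla_step l g b1 b2" for b1 b2
    proof -
      obtain b where "lla_run l g b2 b" using run by blast
      then have "lla_run l g b0 (case_nat b0 (case_nat b1 b))" "b 0 = b2"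
        by (blast intro: cons that, simp add: lla_run_def)
      from all[OF this(1), of 2] this(2) show ?thesis by (simp add: numeral_2_eq_2)
    qed
    moreover have "b' = x" if "lla_step l g x b'" for b'
    proof -
      obtain b1 b2 where b: "lla_step l g b0 b1" "lla_step l g b1 b2" using total by blast
      then have "b2 = x" by (rule 1)
      obtain b where "lla_run l g b' b" using run by blast
      moreover have "lla_step l g b1 x" using b(2) \<open>b2 = x\<close> by simp
      ultimately have "lla_run l g b0 (case_nat b0 (case_nat b1 (case_nat x b)))" "b 0 = b'"
        by (blast intro: cons that b(1), simp add: lla_run_def)
      from all[OF this(1), of 3] this(2) show ?thesis by (simp add: numeral_3_eq_3)
    qed
    ultimately show "(\<forall>b1 b2. lla_step l g b0 b1 \<longrightarrow> lla_step l g b1 b2 \<longrightarrow> b2 = x) \<and>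
      (\<forall>b'. lla_step l g x b' \<longrightarrow> b' = x)" by blast
  next
    assume R: "(\<forall>b1 b2. lla_step l g b0 b1 \<longrightarrow> lla_step l g b1 b2 \<longrightarrow> b2 = x) \<and>
      (\<forall>b'. lla_step l g x b' \<longrightarrow> b' = x)"
    have "b k = x" if "lla_run l g b0 b" "k \<ge> 2" for b k
      using that(2)
    proof (induction k rule: dec_induct)
      case base
      have "lla_step l g b0 (b 1)" "lla_step l g (b 1) (b 2)"
        using that(1) by (auto simp: lla_run_def numeral_2_eq_2)
      then show ?case using R by blast
    next
      case (step k)
      then show ?case using that(1) R by (auto simp: lla_run_def)
    qed
    then show "lla_converges_after_two_steps l g b0 x"
      using run by (auto simp: lla_converges_after_two_steps_def)
  qed
qed

lemma lla_step_total:
  assumes "\<And>t. 0 \<le> t \<Longrightarrow> 0 \<le> pen_deriv g t"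
  shows "\<exists>b'. lla_step (ls_loss y) g b b'"
  using symmetric_eigenbasis_exists[OF transpose_laplacian[of "\<bar>b\<bar>"]]
  by (auto simp: lla_step_iff[OF assms])

lemma block_oracle_nth:
  "block_oracle x y $ e = (if e \<in> within_pairs x then y $ e else 0)"
proof -
  let ?P = "\<lambda>\<beta>. \<forall>e. e \<notin> within_pairs x \<longrightarrow> \<beta> $ e = 0"
  let ?s = "\<chi> e. if e \<in> within_pairs x then y $ e else 0"
  have strong: "ls_loss y ?s + ls_loss \<beta> ?s \<le> ls_loss y \<beta>" if "?P \<beta>" for \<beta>
    unfolding ls_loss_eq_sum sum.distrib[symmetric]
    by (intro sum_mono) (auto simp: that power2_commute)
  have nn: "0 \<le> ls_loss \<beta> ?s" for \<beta> by (simp add: ls_loss_def)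
  have "is_arg_min (ls_loss y) ?P ?s"
    unfolding is_arg_min_def
  proof (intro conjI notI)
    assume "\<exists>\<beta>. ?P \<beta> \<and> ls_loss y \<beta> < ls_loss y ?s"
    then obtain \<beta> where "?P \<beta>" "ls_loss y \<beta> < ls_loss y ?s" by blast
    with strong[OF \<open>?P \<beta>\<close>] nn[of \<beta>] show False by linarith
  qed simp
  then have "is_arg_min (ls_loss y) ?P (block_oracle x y)"
    unfolding block_oracle_def arg_min_def by (rule someI)
  moreover have "?P ?s" by simp
  ultimately have P: "?P (block_oracle x y)" and "\<not> ls_loss y ?s < ls_loss y (block_oracle x y)"
    unfolding is_arg_min_def by blast+
  with strong[OF P] nn[of "block_oracle x y"] have "ls_loss (block_oracle x y) ?s = 0" by linarith
  then have "block_oracle x y = ?s" by (simp add: ls_loss_def)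
  then show ?thesis by simp
qed

section \<open>The two updates on the good event\<close>

lemma edge_weights_eq_coordinates:
  assumes "i \<noteq> j"
  shows "edge_weights V w $ edge i j = (\<Sum>k\<in>UNIV. w $ k * (column k V \<bullet> (axis i 1 - axis j 1))\<^sup>2)"
  by (simp add: edge_weights_nth[OF assms] inner_diff_right inner_axis column_def)

lemma axis_diff_orthogonal_decomposition:
  assumes "v \<in> block_constant x"
  shows "v \<bullet> (axis i 1 - axis j 1 - (block_average x i - block_average x j)) = 0"
  using assms by (simp add: inner_diff_right inner_axis inner_block_average)

lemma norm_axis_diff: "i \<noteq> j \<Longrightarrow> (norm (axis i 1 - axis j 1 :: real^'d))\<^sup>2 = 2"
  unfolding power2_norm_eq_inner by (simp add: inner_diff_left inner_diff_right inner_axis_axis)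

lemma L2_set_coordinates_UNIV: "eigenbasis A V \<Lambda> \<Longrightarrow> L2_set (\<lambda>k. column k V \<bullet> x) UNIV = norm x"
  unfolding L2_set_def by (simp add: eigenbasis_norm[symmetric])

lemma L2_set_union_le: "L2_set f (UNIV :: 'a::finite set) \<le> L2_set f L + L2_set f (- L)"
proof -
  have "L2_set f UNIV = L2_set (\<lambda>k. (if k \<in> L then f k else 0) + (if k \<in> L then 0 else f k)) UNIV"
    by (intro L2_set_cong) auto
  also have "\<dots> \<le> L2_set (\<lambda>k. if k \<in> L then f k else 0) UNIV + L2_set (\<lambda>k. if k \<in> L then 0 else f k) UNIV"
    by (rule L2_set_triangle_ineq)
  also have "L2_set (\<lambda>k. if k \<in> L then f k else 0) UNIV = L2_set f L"
    unfolding L2_set_def by (auto intro!: arg_cong[where f = sqrt] sum.mono_neutral_cong_right)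
  also have "L2_set (\<lambda>k. if k \<in> L then 0 else f k) UNIV = L2_set f (- L)"
    unfolding L2_set_def by (auto intro!: arg_cong[where f = sqrt] sum.mono_neutral_cong_right)
  finally show ?thesis by simp
qed

text \<open>
  In the proof, \<open>L\<close> is the set of indices of the low eigenvalues and \<open>low x\<close> the length of the part of
  \<open>x\<close> in the span of their eigenvectors. With \<open>z = axis i 1 - axis j 1\<close> the weight \<open>M\<close> of \<open>(ij)\<close>
  lies between \<open>a1 * \<tau> * (low z)\<^sup>2\<close> and \<open>a0 * \<tau> * (low z)\<^sup>2\<close>. Within a component
  \<open>low z \<le> 2 * c * norm z\<close>. Across components, \<open>z = u + (z - u)\<close> with \<open>u\<close> the block-constant part; the low
  part of \<open>u\<close> loses at most \<open>norm u / 63\<close> and that of \<open>z - u\<close> is at most \<open>norm u / 32\<close>, which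
  leaves \<open>low z \<ge> norm u / 2\<close>.
\<close>

lemma first_update_near_target:
  fixes b y \<beta>s :: "real ^ ('d::card2) edge" and d :: real
  assumes g: "scad_like a0 a1 b1 b2 \<tau> g" and par: "a1 \<le> a0" "0 < a1" "b1 < b2" "0 < b1" "0 < \<tau>"
    and d: "d = real (max_component_size \<beta>s)" and "\<beta>s \<noteq> 0"
    and gap: "(b1 + b2) * \<tau> \<le> eigenvalue_nth (card (graph_components \<beta>s) + 1) (laplacian \<bar>\<beta>s\<bar>)"
    and pert: "\<And>x. norm (laplacian \<bar>b\<bar> *v x - laplacian \<bar>\<beta>s\<bar> *v x) \<le> c * ((b1 + b2) * \<tau>) * norm x"
    and c: "0 \<le> c" "c\<^sup>2 \<le> b1 / (2^7 * a0 * d)" "c \<le> 1 / 2^6 * sqrt (a1 / (a0 * d))" "c < b1 / (b1 + b2)"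
    and y: "\<And>e. e \<notin> within_pairs \<beta>s \<Longrightarrow> \<bar>y $ e\<bar> \<le> a1 * \<tau> / (4 * d)"
    and eb: "eigenbasis (laplacian \<bar>b\<bar>) V \<Lambda>"
  shows "e \<notin> within_pairs \<beta>s \<Longrightarrow> lla_update g y V \<Lambda> $ e = 0"
    and "e \<in> within_pairs \<beta>s \<Longrightarrow> \<bar>lla_update g y V \<Lambda> $ e - y $ e\<bar> \<le> b1 * \<tau> / (2^5 * d)"
proof -
  obtain W \<Omega> where eb': "eigenbasis (laplacian \<bar>\<beta>s\<bar>) W \<Omega>"
    using symmetric_eigenbasis_exists[OF transpose_laplacian] by blast
  define D where "D = (b1 + b2) * \<tau>"
  have D: "0 < D" using par by (simp add: D_def)
  have a0: "0 < a0" using par by simp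
  have d2: "2 \<le> d" using two_le_max_component_size[OF \<open>\<beta>s \<noteq> 0\<close>] by (simp add: d)
  have gap': "\<Omega> $ j \<noteq> 0 \<Longrightarrow> D \<le> \<Omega> $ j" for j
    using laplacian_spectral_gap[OF eb' gap] by (simp add: D_def)
  have \<Lambda>0: "0 \<le> \<Lambda> $ k" for k by (rule laplacian_abs_eigenvalue_nonneg[OF eb])
  have pert': "norm (laplacian \<bar>b\<bar> *v x - laplacian \<bar>\<beta>s\<bar> *v x) \<le> c * D * norm x" for x
    using pert[of x] by (simp add: D_def)
  have sep: "\<Lambda> $ k \<le> c * D \<or> D - c * D \<le> \<Lambda> $ k" for k
    by (rule eigenvalue_separation[OF eb transpose_laplacian eb' transpose_laplacian gap' pert' \<Lambda>0])
  have cD: "c * D < b1 * \<tau>"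
  proof -
    have "c * (b1 + b2) < b1" using c(4) par by (simp add: pos_less_divide_eq)
    from mult_strict_right_mono[OF this \<open>0 < \<tau>\<close>] show ?thesis by (simp add: D_def mult.assoc)
  qed
  have quot: "a1 / (a0 * d) \<le> 1"
    using par a0 d2 mult_mono[of a1 a0 1 d] by (simp add: divide_le_eq)
  have c64: "c \<le> 1 / 64"
  proof -
    have "c * 64 \<le> sqrt (a1 / (a0 * d))" using c(3) by simp
    also have "\<dots> \<le> 1" using quot by simp
    finally show ?thesis by simp
  qed
  define L where "L = {k. \<Lambda> $ k \<le> c * D}"
  define w where "w k = pen_deriv g (\<Lambda> $ k)" for k
  have w_low: "a1 * \<tau> \<le> w k" "w k \<le> a0 * \<tau>" if "k \<in> L" for k
    using that cD par scad_like_pen_deriv_ge[OF g \<Lambda>0] scad_like_pen_deriv_le[OF g \<Lambda>0]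
    by (auto simp: L_def w_def)
  have w_high: "w k = 0" if "k \<notin> L" for k
  proof -
    have "D - c * D \<le> \<Lambda> $ k" using sep[of k] that by (auto simp: L_def)
    moreover have "D - c * D \<ge> b2 * \<tau>" using cD by (simp add: D_def algebra_simps)
    ultimately show ?thesis using g \<Lambda>0[of k] by (auto simp: scad_like_def w_def)
  qed
  define low where "low x = L2_set (\<lambda>k. column k V \<bullet> x) L" for x
  have low0: "0 \<le> low x" for x by (simp add: low_def)
  have low2: "(low x)\<^sup>2 = (\<Sum>k\<in>L. (column k V \<bullet> x)\<^sup>2)" for x
    by (simp add: low_def L2_set_def sum_nonneg)
  define M where "M = edge_weights V (\<chi> k. w k)"
  have M: "M $ edge i j = (\<Sum>k\<in>L. w k * (column k V \<bullet> (axis i 1 - axis j 1))\<^sup>2)" if "i \<noteq> j" for i j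
    unfolding M_def edge_weights_eq_coordinates[OF that]
    by (intro sum.mono_neutral_cong_right) (auto simp: w_high)
  have M_le: "M $ edge i j \<le> a0 * \<tau> * (low (axis i 1 - axis j 1))\<^sup>2" if "i \<noteq> j" for i j
    unfolding M[OF that] low2 sum_distrib_left by (intro sum_mono mult_right_mono w_low) auto
  have M_ge: "a1 * \<tau> * (low (axis i 1 - axis j 1))\<^sup>2 \<le> M $ edge i j" if "i \<noteq> j" for i j
    unfolding M[OF that] low2 sum_distrib_left by (intro sum_mono mult_right_mono w_low) auto
  have M0: "0 \<le> M $ e" for e
    unfolding M_def by (intro edge_weights_nonneg) (simp add: w_def scad_like_pen_deriv_nonneg[OF g \<Lambda>0])
  have upd: "lla_update g y V \<Lambda> $ e = soft_threshold (M $ e / 2) (y $ e)" for e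
    by (simp add: lla_update_def M_def w_def)
  have comp_low: "low x \<le> 2 * c * norm x" if "\<And>v. v \<in> block_constant \<beta>s \<Longrightarrow> v \<bullet> x = 0" for x
  proof -
    have "low x \<le> 2 * (c * D) / D * norm x"
      unfolding low_def
      by (rule kernel_complement_low_part[OF eb transpose_laplacian eb' transpose_laplacian gap' D pert'])
        (use c(1) D \<Lambda>0 that in \<open>auto simp: L_def laplacian_kernel\<close>)
    then show ?thesis using D by simp
  qed
  obtain i j where ij: "i \<noteq> j" "e = edge i j" by (rule edge_exhaust)
  define z where "z = (axis i 1 - axis j 1 :: real^'d::card2)"
  have nz: "(norm z)\<^sup>2 = 2" unfolding z_def by (rule norm_axis_diff[OF ij(1)])
  define u where "u = block_average \<beta>s i - block_average \<beta>s j"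
  have u: "u \<in> block_constant \<beta>s"
    unfolding u_def by (intro block_constant_diff block_average_block_constant)
  have perp: "v \<bullet> (z - u) = 0" if "v \<in> block_constant \<beta>s" for v
    unfolding z_def u_def by (rule axis_diff_orthogonal_decomposition[OF that])
  {
    assume "e \<in> within_pairs \<beta>s"
    then have "u = 0"
      using ij by (auto simp: edge_in_within_pairs u_def dest: block_average_eq)
    then have "low z \<le> 2 * c * norm z" using comp_low[of z] perp by simp
    then have "(low z)\<^sup>2 \<le> (2 * c * norm z)\<^sup>2" using low0 by (intro power_mono)
    also have "\<dots> = 8 * c\<^sup>2" by (simp add: power_mult_distrib nz)
    finally have "M $ e \<le> a0 * \<tau> * (8 * c\<^sup>2)"
      using M_le[OF ij(1)] a0 par by (simp add: ij(2) z_def order_trans mult_left_mono)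
    also have "\<dots> \<le> a0 * \<tau> * (8 * (b1 / (2^7 * a0 * d)))"
      using c(2) a0 par by (intro mult_left_mono) auto
    also have "\<dots> = 2 * (b1 * \<tau> / (2^5 * d))" using a0 d2 by (simp add: field_simps)
    finally have M_half: "M $ e / 2 \<le> 2 * (b1 * \<tau> / (2^5 * d)) / 2" by (rule divide_right_mono) simp
    have "\<bar>lla_update g y V \<Lambda> $ e - y $ e\<bar> \<le> M $ e / 2"
      unfolding upd using M0[of e] by (intro soft_threshold_dist) simp
    also note M_half
    also have "2 * (b1 * \<tau> / (2^5 * d)) / 2 = b1 * \<tau> / (2^5 * d)" by (rule nonzero_mult_div_cancel_left) simp
    finally show "\<bar>lla_update g y V \<Lambda> $ e - y $ e\<bar> \<le> b1 * \<tau> / (2^5 * d)" .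
  next
    assume e: "e \<notin> within_pairs \<beta>s"
    then have nu: "2 / d \<le> (norm u)\<^sup>2"
      unfolding u_def d using ij by (intro norm_block_average_diff) (simp add: edge_in_within_pairs)
    have "u \<bullet> z = u \<bullet> u" using perp[OF u] by (simp add: inner_diff_right)
    then have "(norm z)\<^sup>2 = (norm (z - u))\<^sup>2 + (norm u)\<^sup>2"
      by (simp add: power2_norm_eq_inner inner_diff_left inner_diff_right inner_commute)
    then have "(norm (z - u))\<^sup>2 \<le> 2" using nz zero_le_power2[of "norm u"] by linarith
    then have nw: "norm (z - u) \<le> sqrt 2" by (rule real_le_rsqrt)
    have "low (z - u) \<le> 2 * c * sqrt 2"
      using comp_low[OF perp] nw c(1) by (meson mult_left_mono mult_nonneg_nonneg order_trans zero_le_numeral)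
    also have "\<dots> \<le> 2 * (1 / 2^6 * sqrt (1 / d)) * sqrt 2"
    proof -
      have "a1 / (a0 * d) \<le> 1 / d" using par a0 d2 by (simp add: field_simps)
      then have "c \<le> 1 / 2^6 * sqrt (1 / d)" using c(3) by (smt (verit) real_sqrt_le_mono divide_nonneg_nonneg mult_left_mono zero_le_power)
      then show ?thesis by (intro mult_right_mono mult_left_mono) auto
    qed
    also have "\<dots> = 1 / 2^5 * sqrt (2 / d)" by (simp add: real_sqrt_divide)
    also have "\<dots> \<le> 1 / 2^5 * norm u"
    proof (rule mult_left_mono)
      show "sqrt (2 / d) \<le> norm u" by (rule real_le_lsqrt) (use nu d2 in auto)
    qed simp
    finally have low_w: "low (z - u) \<le> norm u / 32" by simp
    have high_u: "L2_set (\<lambda>k. column k V \<bullet> u) (- L) \<le> (c * D) / (D - c * D) * norm u"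
      by (rule kernel_vector_high_part[OF eb transpose_laplacian pert'])
        (use u sep D c64 in \<open>auto simp: laplacian_kernel L_def algebra_simps\<close>)
    have "c * D \<le> 1 / 64 * D" using c64 D by (intro mult_right_mono) auto
    moreover have "s / (D - s) \<le> 1 / 63" if "s \<le> 1 / 64 * D" for s
      using that D by (simp add: field_simps)
    ultimately have "(c * D) / (D - c * D) \<le> 1 / 63" by blast
    then have "(c * D) / (D - c * D) * norm u \<le> 1 / 63 * norm u" by (intro mult_right_mono) auto
    with high_u have "L2_set (\<lambda>k. column k V \<bullet> u) (- L) \<le> 1 / 63 * norm u" by (rule order_trans)
    moreover have "norm u \<le> low u + L2_set (\<lambda>k. column k V \<bullet> u) (- L)"
      using L2_set_union_le[of "\<lambda>k. column k V \<bullet> u" L] L2_set_coordinates_UNIV[OF eb, of u] by (simp add: low_def)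
    ultimately have low_u: "norm u * (62 / 63) \<le> low u" by linarith
    have "low u \<le> low z + low (u - z)"
      using L2_set_triangle_ineq[of "\<lambda>k. column k V \<bullet> z" "\<lambda>k. column k V \<bullet> (u - z)" L]
      by (simp add: low_def inner_diff_right)
    moreover have "low (u - z) = low (z - u)"
      unfolding low_def by (simp add: L2_set_def inner_diff_right power2_commute)
    ultimately have "norm u / 2 \<le> low z" using low_u low_w norm_ge_zero[of u] by linarith
    then have "(norm u / 2)\<^sup>2 \<le> (low z)\<^sup>2" by (intro power_mono) auto
    then have "1 / (2 * d) \<le> (low z)\<^sup>2" using nu d2 by (simp add: power_divide)
    then have "a1 * \<tau> * (1 / (2 * d)) \<le> a1 * \<tau> * (low z)\<^sup>2" using par by (intro mult_left_mono) auto
    also have "\<dots> \<le> M $ e" using M_ge[OF ij(1)] by (simp add: ij(2) z_def)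
    finally have "a1 * \<tau> * (1 / (2 * d)) / 2 \<le> M $ e / 2" by (rule divide_right_mono) simp
    moreover have "a1 * \<tau> / (4 * d) = a1 * \<tau> * (1 / (2 * d)) / 2" using d2 by (simp add: field_simps)
    ultimately have "\<bar>y $ e\<bar> \<le> M $ e / 2" using order_trans[OF y[OF e]] by (simp only:)
    then show "lla_update g y V \<Lambda> $ e = 0"
      unfolding upd by (rule soft_threshold_eq_0)
  }
qed

text \<open>
  Only pairs within a component contribute, each node has at most \<open>max_component_size\<close> partners, and
  \<open>(s - t)\<^sup>2 \<le> 2 * s\<^sup>2 + 2 * t\<^sup>2\<close>.
\<close>

lemma laplacian_block_quadratic_bound:
  fixes h \<beta>s :: "real ^ ('d::card2) edge"
  assumes "\<And>e. e \<in> within_pairs \<beta>s \<Longrightarrow> \<bar>h $ e\<bar> \<le> \<eta>" "\<And>e. e \<notin> within_pairs \<beta>s \<Longrightarrow> h $ e = 0" "0 \<le> \<eta>"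
  shows "\<bar>x \<bullet> (laplacian h *v x)\<bar> \<le> 2 * \<eta> * real (max_component_size \<beta>s) * (norm x)\<^sup>2"
proof -
  let ?d = "real (max_component_size \<beta>s)"
  let ?c = "\<lambda>i j. if (i, j) \<in> connectivity \<beta>s then 1 else 0 :: real"
  have adj: "\<bar>adjacency h $ i $ j\<bar> \<le> \<eta> * ?c i j" for i j
    using assms by (cases "i = j") (auto simp: adjacency_nth edge_in_within_pairs)
  have summand: "\<bar>adjacency h $ i $ j * (x $ i - x $ j)\<^sup>2\<bar> \<le> \<eta> * ?c i j * (2 * (x $ i)\<^sup>2 + 2 * (x $ j)\<^sup>2)" for i j
  proof -
    have "(x $ i - x $ j)\<^sup>2 \<le> 2 * (x $ i)\<^sup>2 + 2 * (x $ j)\<^sup>2"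
      using zero_le_power2[of "x $ i + x $ j"] by (simp add: power2_eq_square algebra_simps)
    then show ?thesis using adj[of i j] by (auto simp: abs_mult intro!: mult_mono)
  qed
  have card: "(\<Sum>j\<in>UNIV. ?c i j) = real (card (component \<beta>s i))" for i
    by (simp add: sum.If_cases component_def Image_singleton)
  have half: "(\<Sum>i\<in>UNIV. \<Sum>j\<in>UNIV. ?c i j * (x $ i)\<^sup>2) \<le> ?d * (norm x)\<^sup>2"
  proof -
    have "(\<Sum>i\<in>UNIV. \<Sum>j\<in>UNIV. ?c i j * (x $ i)\<^sup>2) = (\<Sum>i\<in>UNIV. real (card (component \<beta>s i)) * (x $ i)\<^sup>2)"
      by (simp add: sum_distrib_right[symmetric] card)
    also have "\<dots> \<le> (\<Sum>i\<in>UNIV. ?d * (x $ i)\<^sup>2)"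
      by (intro sum_mono mult_right_mono) (auto simp: card_component_le)
    also have "\<dots> = ?d * (norm x)\<^sup>2"
      unfolding power2_norm_eq_inner inner_vec_def by (simp add: sum_distrib_left power2_eq_square)
    finally show ?thesis .
  qed
  have "(\<Sum>i\<in>UNIV. \<Sum>j\<in>UNIV. ?c i j * (x $ j)\<^sup>2) = (\<Sum>i\<in>UNIV. \<Sum>j\<in>UNIV. ?c j i * (x $ i)\<^sup>2)"
    by (rule sum.swap)
  also have "\<dots> = (\<Sum>i\<in>UNIV. \<Sum>j\<in>UNIV. ?c i j * (x $ i)\<^sup>2)"
    by (intro sum.cong refl) (auto dest: connectivity_sym)
  finally have swap: "(\<Sum>i\<in>UNIV. \<Sum>j\<in>UNIV. ?c i j * (x $ j)\<^sup>2) = (\<Sum>i\<in>UNIV. \<Sum>j\<in>UNIV. ?c i j * (x $ i)\<^sup>2)" .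
  have "2 * \<bar>x \<bullet> (laplacian h *v x)\<bar> = \<bar>\<Sum>i\<in>UNIV. \<Sum>j\<in>UNIV. adjacency h $ i $ j * (x $ i - x $ j)\<^sup>2\<bar>"
    by (simp add: laplacian_quadratic_form abs_mult)
  also have "\<dots> \<le> (\<Sum>i\<in>UNIV. \<Sum>j\<in>UNIV. \<bar>adjacency h $ i $ j * (x $ i - x $ j)\<^sup>2\<bar>)"
    by (rule order_trans[OF sum_abs sum_mono[OF sum_abs]])
  also have "\<dots> \<le> (\<Sum>i\<in>UNIV. \<Sum>j\<in>UNIV. \<eta> * ?c i j * (2 * (x $ i)\<^sup>2 + 2 * (x $ j)\<^sup>2))"
    by (intro sum_mono summand)
  also have "\<dots> = 2 * \<eta> * ((\<Sum>i\<in>UNIV. \<Sum>j\<in>UNIV. ?c i j * (x $ i)\<^sup>2) + (\<Sum>i\<in>UNIV. \<Sum>j\<in>UNIV. ?c i j * (x $ j)\<^sup>2))"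
    unfolding sum.distrib[symmetric] sum_distrib_left by (intro sum.cong refl) (simp add: algebra_simps)
  also have "\<dots> \<le> 2 * \<eta> * (?d * (norm x)\<^sup>2 + ?d * (norm x)\<^sup>2)"
    unfolding swap using half assms(3) by (intro mult_left_mono add_mono) auto
  finally show ?thesis by (simp add: algebra_simps)
qed

text \<open>
  With the constant \<open>b1 * \<tau> / (2 * d)\<close> the bound \<open>laplacian_block_quadratic_bound\<close> becomes
  \<open>b1 * \<tau> * (norm x)\<^sup>2\<close>, so that the gap \<open>(b1 + b2) * \<tau>\<close> shrinks to no less than \<open>b2 * \<tau>\<close>. The weight of
  the pair \<open>(ij)\<close> is then \<open>a0 * \<tau>\<close> times the squared length of the block-constant part of
  \<open>axis i 1 - axis j 1\<close>.
\<close>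

lemma second_update_is_oracle:
  fixes b y \<beta>s :: "real ^ ('d::card2) edge" and d :: real
  assumes g: "scad_like a0 a1 b1 b2 \<tau> g" and par: "a1 \<le> a0" "0 < a1" "b1 < b2" "0 < b1" "0 < \<tau>"
    and d: "d = real (max_component_size \<beta>s)" and "\<beta>s \<noteq> 0"
    and gap: "(b1 + b2) * \<tau> \<le> eigenvalue_nth (card (graph_components \<beta>s) + 1) (laplacian \<bar>\<beta>s\<bar>)"
    and off: "\<And>e. e \<notin> within_pairs \<beta>s \<Longrightarrow> b $ e = 0"
    and near: "\<And>e. e \<in> within_pairs \<beta>s \<Longrightarrow> \<bar>b $ e - \<beta>s $ e\<bar> \<le> b1 * \<tau> / (2 * d)"
    and y: "\<And>e. e \<notin> within_pairs \<beta>s \<Longrightarrow> \<bar>y $ e\<bar> \<le> a1 * \<tau> / (4 * d)"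
    and eb: "eigenbasis (laplacian \<bar>b\<bar>) V \<Lambda>"
  shows "lla_update g y V \<Lambda> = block_oracle \<beta>s y"
proof -
  obtain W \<Omega> where eb': "eigenbasis (laplacian \<bar>\<beta>s\<bar>) W \<Omega>"
    using symmetric_eigenbasis_exists[OF transpose_laplacian] by blast
  define D where "D = (b1 + b2) * \<tau>"
  have a0: "0 < a0" using par by simp
  have d2: "2 \<le> d" using two_le_max_component_size[OF \<open>\<beta>s \<noteq> 0\<close>] by (simp add: d)
  have gap': "\<Omega> $ j \<noteq> 0 \<Longrightarrow> D \<le> \<Omega> $ j" for j
    using laplacian_spectral_gap[OF eb' gap] by (simp add: D_def)
  have \<Lambda>0: "0 \<le> \<Lambda> $ k" for k by (rule laplacian_abs_eigenvalue_nonneg[OF eb])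
  have pert: "x \<bullet> (laplacian \<bar>\<beta>s\<bar> *v x) - b1 * \<tau> * (norm x)\<^sup>2 \<le> x \<bullet> (laplacian \<bar>b\<bar> *v x)" for x
  proof -
    have "\<bar>x \<bullet> (laplacian (\<bar>b\<bar> - \<bar>\<beta>s\<bar>) *v x)\<bar>
      \<le> 2 * (b1 * \<tau> / (2 * d)) * real (max_component_size \<beta>s) * (norm x)\<^sup>2"
    proof (rule laplacian_block_quadratic_bound)
      fix e assume "e \<in> within_pairs \<beta>s"
      from near[OF this] show "\<bar>(\<bar>b\<bar> - \<bar>\<beta>s\<bar>) $ e\<bar> \<le> b1 * \<tau> / (2 * d)"
        by (simp add: abs_vec_nth)
    next
      fix e assume "e \<notin> within_pairs \<beta>s"
      then show "(\<bar>b\<bar> - \<bar>\<beta>s\<bar>) $ e = 0"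
        using off zero_outside_within_pairs by (simp add: abs_vec_nth)
    qed (use par d2 in auto)
    then show ?thesis
      using d2 by (simp add: laplacian_diff_mult inner_diff_right d[symmetric])
  qed
  have ker: "laplacian \<bar>b\<bar> *v u = 0" if "laplacian \<bar>\<beta>s\<bar> *v u = 0" for u
  proof -
    have u: "u \<in> block_constant \<beta>s" using that by (simp add: laplacian_kernel)
    have "adjacency \<bar>b\<bar> $ i $ j * (u $ i - u $ j) = 0" for i j
      using u off[of "edge i j"]
      by (cases "i = j") (auto simp: adjacency_nth abs_vec_nth edge_in_within_pairs block_constant_def)
    then show ?thesis unfolding vec_eq_iff laplacian_mult_nth zero_index
      by (intro allI sum.neutral) auto
  qed
  have "b1 * \<tau> < D" using par by (simp add: D_def)
  have nonzero: "D - b1 * \<tau> \<le> \<Lambda> $ k" if "\<Lambda> $ k \<noteq> 0" for k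
    by (rule same_kernel_eigenvalue_gap(1)[OF eb transpose_laplacian eb' transpose_laplacian gap' ker pert \<open>b1 * \<tau> < D\<close> that])
  have ker': "laplacian \<bar>\<beta>s\<bar> *v x = 0" if "laplacian \<bar>b\<bar> *v x = 0" for x
    by (rule same_kernel_eigenvalue_gap(2)[OF eb transpose_laplacian eb' transpose_laplacian gap' ker pert \<open>b1 * \<tau> < D\<close> that])
  define Z where "Z = {k. \<Lambda> $ k = 0}"
  have weight: "pen_deriv g (\<Lambda> $ k) = (if k \<in> Z then a0 * \<tau> else 0)" for k
  proof (cases "k \<in> Z")
    case True
    then show ?thesis using scad_like_pen_deriv_0[OF g] by (simp add: Z_def)
  next
    case False
    then have "b2 * \<tau> \<le> \<Lambda> $ k" using nonzero[of k] by (simp add: Z_def D_def algebra_simps)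
    then show ?thesis using False g \<Lambda>0[of k] by (simp add: scad_like_def)
  qed
  have col: "column k V \<in> block_constant \<beta>s" if "k \<in> Z" for k
  proof -
    have "laplacian \<bar>b\<bar> *v column k V = 0"
      using that eigenbasis_eigenvector[OF eb, of k] by (simp add: Z_def)
    from ker'[OF this] show ?thesis by (simp add: laplacian_kernel)
  qed
  have col': "column k V \<bullet> u = 0" if "k \<notin> Z" "u \<in> block_constant \<beta>s" for k u
  proof -
    have "laplacian \<bar>b\<bar> *v u = 0" using that(2) by (intro ker) (simp add: laplacian_kernel)
    then show ?thesis using eigenbasis_coord_mult[OF eb transpose_laplacian, of k u] that(1)
      by (simp add: Z_def)
  qed
  have M: "edge_weights V (\<chi> k. pen_deriv g (\<Lambda> $ k)) $ edge i j
      = a0 * \<tau> * (norm (block_average \<beta>s i - block_average \<beta>s j))\<^sup>2" if "i \<noteq> j" for i j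
  proof -
    let ?u = "block_average \<beta>s i - block_average \<beta>s j"
    let ?z = "axis i 1 - axis j 1 :: real^'d::card2"
    have u: "?u \<in> block_constant \<beta>s"
      by (intro block_constant_diff block_average_block_constant)
    have "pen_deriv g (\<Lambda> $ k) * (column k V \<bullet> ?z)\<^sup>2 = a0 * \<tau> * (column k V \<bullet> ?u)\<^sup>2" for k
    proof (cases "k \<in> Z")
      case True
      then have "column k V \<bullet> ?z = column k V \<bullet> ?u"
        using axis_diff_orthogonal_decomposition[OF col[OF True], of i j] by (simp add: inner_diff_right)
      then show ?thesis using True by (simp add: weight)
    next
      case False
      then show ?thesis using col'[OF False u] by (simp add: weight)
    qed
    then show ?thesis
      by (simp add: edge_weights_eq_coordinates[OF that] eigenbasis_norm[OF eb, of ?u] sum_distrib_left)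
  qed
  have "lla_update g y V \<Lambda> $ e = block_oracle \<beta>s y $ e" for e
  proof -
    obtain i j where ij: "i \<noteq> j" "e = edge i j" by (rule edge_exhaust)
    show ?thesis
    proof (cases "e \<in> within_pairs \<beta>s")
      case True
      then have "block_average \<beta>s i = block_average \<beta>s j"
        using ij by (intro block_average_eq) (simp add: edge_in_within_pairs)
      then show ?thesis using True M[OF ij(1)]
        by (simp add: lla_update_def block_oracle_nth ij(2)[symmetric] soft_threshold_0)
    next
      case False
      then have "2 / d \<le> (norm (block_average \<beta>s i - block_average \<beta>s j))\<^sup>2"
        unfolding d using ij by (intro norm_block_average_diff) (simp add: edge_in_within_pairs)
      then have lower: "a0 * \<tau> * (2 / d) \<le> edge_weights V (\<chi> k. pen_deriv g (\<Lambda> $ k)) $ e"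
        unfolding ij(2) M[OF ij(1)] using a0 par by (intro mult_left_mono) auto
      have "\<bar>y $ e\<bar> \<le> a1 * \<tau> / (4 * d)" by (rule y[OF False])
      also have "\<dots> \<le> a0 * \<tau> * (2 / d) / 2"
      proof -
        have "a1 * \<tau> / (4 * d) \<le> a0 * \<tau> / d" using par a0 d2 by (intro frac_le mult_right_mono) auto
        then show ?thesis by simp
      qed
      also have "\<dots> \<le> edge_weights V (\<chi> k. pen_deriv g (\<Lambda> $ k)) $ e / 2"
        by (rule divide_right_mono[OF lower]) simp
      finally have "\<bar>y $ e\<bar> \<le> edge_weights V (\<chi> k. pen_deriv g (\<Lambda> $ k)) $ e / 2" .
      then show ?thesis using False by (simp add: lla_update_def block_oracle_nth soft_threshold_eq_0)
    qed
  qed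
  then show ?thesis by (simp add: vec_eq_iff)
qed

theorem lla_converges_on_good_event:
  fixes b0 y \<beta>s :: "real ^ ('d::card2) edge" and d :: real
  assumes g: "scad_like a0 a1 b1 b2 \<tau> g" and par: "a1 \<le> a0" "0 < a1" "b1 < b2" "0 < b1" "0 < \<tau>"
    and d: "d = real (max_component_size \<beta>s)" and "\<beta>s \<noteq> 0"
    and gap: "(b1 + b2) * \<tau> \<le> eigenvalue_nth (card (graph_components \<beta>s) + 1) (laplacian \<bar>\<beta>s\<bar>)"
    and \<rho>: "0 \<le> \<rho>" "\<rho> \<le> sqrt (b1 / (2^7 * a0 * d))"
    and init: "spectral_norm (laplacian (\<bar>b0\<bar> - \<bar>\<beta>s\<bar>))
      < Min {\<rho>, 1 / 2^6 * sqrt (a1 / (a0 * d)), b1 / (b1 + b2)} * (b1 + b2) * \<tau>"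
    and y_off: "\<And>e. e \<notin> within_pairs \<beta>s \<Longrightarrow> \<bar>y $ e - \<beta>s $ e\<bar> \<le> a1 * \<tau> / (4 * d)"
    and y_on: "\<And>e. e \<in> within_pairs \<beta>s \<Longrightarrow> \<bar>y $ e - \<beta>s $ e\<bar> \<le> b1 * \<tau> / (4 * d)"
  shows "lla_converges_after_two_steps (ls_loss y) g b0 (block_oracle \<beta>s y)"
proof -
  define c where "c = spectral_norm (laplacian (\<bar>b0\<bar> - \<bar>\<beta>s\<bar>)) / ((b1 + b2) * \<tau>)"
  have D: "0 < (b1 + b2) * \<tau>" using par by simp
  have d2: "2 \<le> d" using two_le_max_component_size[OF \<open>\<beta>s \<noteq> 0\<close>] by (simp add: d)
  have on: "spectral_norm (laplacian (\<bar>b0\<bar> - \<bar>\<beta>s\<bar>)) = c * ((b1 + b2) * \<tau>)"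
    using D par by (simp add: c_def)
  have "c < Min {\<rho>, 1 / 2^6 * sqrt (a1 / (a0 * d)), b1 / (b1 + b2)}"
    using init D unfolding on by (simp only: mult.assoc mult_less_cancel_right_pos)
  then have c: "c < \<rho>" "c \<le> 1 / 2^6 * sqrt (a1 / (a0 * d))" "c < b1 / (b1 + b2)"
    by simp_all
  have c0: "0 \<le> c"
    unfolding c_def spectral_norm_def using D
    by (intro divide_nonneg_pos onorm_pos_le matrix_vector_mul_bounded_linear)
  have c2: "c\<^sup>2 \<le> b1 / (2^7 * a0 * d)"
  proof -
    have "c \<le> sqrt (b1 / (2^7 * a0 * d))" using c(1) \<rho> by simp
    then have "c\<^sup>2 \<le> (sqrt (b1 / (2^7 * a0 * d)))\<^sup>2" using c0 by (rule power_mono)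
    then show ?thesis using par d2 by simp
  qed
  have pert: "norm (laplacian \<bar>b0\<bar> *v x - laplacian \<bar>\<beta>s\<bar> *v x) \<le> c * ((b1 + b2) * \<tau>) * norm x" for x
    using onorm[OF matrix_vector_mul_bounded_linear, of "laplacian (\<bar>b0\<bar> - \<bar>\<beta>s\<bar>)" x] on
    by (simp add: laplacian_diff_mult spectral_norm_def)
  have y: "\<bar>y $ e\<bar> \<le> a1 * \<tau> / (4 * d)" if "e \<notin> within_pairs \<beta>s" for e
    using y_off[OF that] zero_outside_within_pairs[OF that] by simp
  have nonneg: "0 \<le> pen_deriv g t" if "0 \<le> t" for t
    by (rule scad_like_pen_deriv_nonneg[OF g that])
  have q: "0 \<le> b1 * \<tau> / d" using par d2 by simp
  have second: "b' = block_oracle \<beta>s y"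
    if st: "lla_step (ls_loss y) g b b'" and "\<And>e. e \<notin> within_pairs \<beta>s \<Longrightarrow> b $ e = 0"
      "\<And>e. e \<in> within_pairs \<beta>s \<Longrightarrow> \<bar>b $ e - \<beta>s $ e\<bar> \<le> b1 * \<tau> / (2 * d)" for b b'
    using st second_update_is_oracle[OF g par d \<open>\<beta>s \<noteq> 0\<close> gap that(2,3) y]
    by (auto simp: lla_step_iff[OF nonneg])
  have total: "\<exists>b'. lla_step (ls_loss y) g b b'" for b
    by (rule lla_step_total[OF nonneg])
  show ?thesis
    unfolding lla_converges_iff[of "ls_loss y" g, OF total]
  proof (intro conjI allI impI)
    fix b1' b2' assume s1: "lla_step (ls_loss y) g b0 b1'" and s2: "lla_step (ls_loss y) g b1' b2'"
    obtain V \<Lambda> where V: "eigenbasis (laplacian \<bar>b0\<bar>) V \<Lambda>" "b1' = lla_update g y V \<Lambda>"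
      using s1 by (auto simp: lla_step_iff[OF nonneg])
    have first: "e \<notin> within_pairs \<beta>s \<Longrightarrow> b1' $ e = 0"
      "e \<in> within_pairs \<beta>s \<Longrightarrow> \<bar>b1' $ e - y $ e\<bar> \<le> b1 * \<tau> / (2^5 * d)" for e
      unfolding V(2)
      by (rule first_update_near_target[OF g par d \<open>\<beta>s \<noteq> 0\<close> gap pert c0 c2 c(2,3) y V(1)]; assumption)+
    show "b2' = block_oracle \<beta>s y"
    proof (rule second[OF s2])
      fix e assume e: "e \<in> within_pairs \<beta>s"
      \<comment> \<open>The shrinkage of the first step and the noise add up: \<open>1/32 + 1/4 \<le> 1/2\<close>.\<close>
      have "\<bar>b1' $ e - \<beta>s $ e\<bar> \<le> b1 * \<tau> / (2^5 * d) + b1 * \<tau> / (4 * d)"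
        using first(2)[OF e] y_on[OF e] by linarith
      also have "\<dots> \<le> b1 * \<tau> / (2 * d)" using q by (simp add: field_simps)
      finally show "\<bar>b1' $ e - \<beta>s $ e\<bar> \<le> b1 * \<tau> / (2 * d)" .
    qed (rule first(1))
  next
    fix b' assume "lla_step (ls_loss y) g (block_oracle \<beta>s y) b'"
    then show "b' = block_oracle \<beta>s y"
    proof (rule second)
      fix e assume e: "e \<in> within_pairs \<beta>s"
      have "b1 * \<tau> / (4 * d) \<le> b1 * \<tau> / (2 * d)" using q by (simp add: field_simps)
      then show "\<bar>block_oracle \<beta>s y $ e - \<beta>s $ e\<bar> \<le> b1 * \<tau> / (2 * d)"
        using y_on[OF e] e by (simp add: block_oracle_nth)
    qed (simp add: block_oracle_nth)
  qed
qed

section \<open>The convergence event is a Borel set\<close>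

lemma compact_orthogonal_matrices: "compact {V :: real^'d^'d. orthogonal_matrix V}"
proof (rule compact_eq_bounded_closed[THEN iffD2], rule conjI)
  have nV: "(norm V)\<^sup>2 = real CARD('d)" if "orthogonal_matrix V" for V :: "real^'d^'d"
  proof -
    have "V ** transpose V = mat 1" using that by (simp add: orthogonal_matrix_def)
    then have "(V ** transpose V) $ i $ i = mat 1 $ i $ i" for i by simp
    then have "V $ i \<bullet> V $ i = 1" for i
      by (simp add: matrix_matrix_mult_def transpose_def mat_def inner_vec_def)
    then show ?thesis unfolding power2_norm_eq_inner by (simp add: inner_vec_def[of V V])
  qed
  show "bounded {V :: real^'d^'d. orthogonal_matrix V}"
    unfolding bounded_iff
    by (rule exI[of _ "sqrt (real CARD('d))"]) (auto simp: nV intro!: real_le_rsqrt)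
  have "{V :: real^'d^'d. orthogonal_matrix V}
    = (\<Inter>i. \<Inter>j. {V. (\<Sum>k\<in>UNIV. V $ k $ i * V $ k $ j) = (if i = j then 1 else 0)})"
    by (auto simp: orthogonal_matrix matrix_matrix_mult_def transpose_def mat_def vec_eq_iff)
  also have "closed \<dots>"
    by (intro closed_INT ballI closed_Collect_eq continuous_intros)
  finally show "closed {V :: real^'d^'d. orthogonal_matrix V}" .
qed

lemma continuous_on_laplacian_abs_mult:
  fixes b :: "'p::topological_space \<Rightarrow> real ^ ('d::card2) edge"
  assumes "continuous_on S b" "continuous_on S u"
  shows "continuous_on S (\<lambda>p. laplacian \<bar>b p\<bar> *v u p)"
proof -
  have "laplacian \<bar>b p\<bar> *v u p =
    (\<chi> i. \<Sum>j\<in>UNIV. (if i = j then 0 else \<bar>b p $ edge i j\<bar>) * (u p $ i - u p $ j))" for p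
    by (simp add: vec_eq_iff laplacian_mult_nth adjacency_nth abs_vec_nth cong: if_cong)
  moreover have "continuous_on S (\<lambda>p. if i = j then 0 else \<bar>b p $ edge i j\<bar>)" for i j
    using assms by (cases "i = j") (auto intro!: continuous_intros)
  ultimately show ?thesis using assms by (auto intro!: continuous_intros)
qed

lemma continuous_on_column:
  fixes V :: "'p::topological_space \<Rightarrow> real ^ 'd ^ 'd"
  assumes "continuous_on S V"
  shows "continuous_on S (\<lambda>p. column k (V p))"
  unfolding column_def using assms by (intro continuous_intros)

text \<open>
  In an eigenbasis these are the eigenvalues (\<open>eigenbasis_rayleigh_quotients\<close>). As a function of the
  vectors they are continuous and nonnegative everywhere, so the choice of an eigenbasis is reduced to
  the choice of \<open>V\<close> in the compact orthogonal group.
\<close>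

definition rayleigh_quotients :: "real ^ ('d::card2) edge \<Rightarrow> real ^ 'd::card2 ^ 'd::card2 \<Rightarrow> real ^ 'd::card2" where
  "rayleigh_quotients b V = (\<chi> k. column k V \<bullet> (laplacian \<bar>b\<bar> *v column k V))"

lemma eigenbasis_rayleigh_quotients:
  "eigenbasis (laplacian \<bar>b\<bar>) V \<Lambda> \<Longrightarrow> \<Lambda> = rayleigh_quotients b V"
  by (simp add: rayleigh_quotients_def vec_eq_iff eigenbasis_eigenvector eigenbasis_orthonormal)

lemma rayleigh_quotients_nonneg: "0 \<le> rayleigh_quotients b V $ k"
  by (simp add: rayleigh_quotients_def laplacian_abs_psd)

lemma continuous_on_rayleigh_quotients:
  fixes b :: "'p::topological_space \<Rightarrow> real ^ ('d::card2) edge"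
  assumes "continuous_on S b" "continuous_on S V"
  shows "continuous_on S (\<lambda>p. rayleigh_quotients (b p) (V p))"
  unfolding rayleigh_quotients_def
  by (intro continuous_intros continuous_on_laplacian_abs_mult continuous_on_column assms)

definition diagonalizes :: "real ^ 'd::card2 ^ 'd::card2 \<Rightarrow> real ^ ('d::card2) edge \<Rightarrow> bool" where
  "diagonalizes V b \<longleftrightarrow>
     (\<forall>k. laplacian \<bar>b\<bar> *v column k V = rayleigh_quotients b V $ k *\<^sub>R column k V)"

lemma closed_diagonalizes:
  fixes b :: "'p::t2_space \<Rightarrow> real ^ ('d::card2) edge"
  assumes "continuous_on UNIV b" "continuous_on UNIV V"
  shows "closed {p. diagonalizes (V p) (b p)}"
proof -
  have "{p. diagonalizes (V p) (b p)}
    = (\<Inter>k. {p. laplacian \<bar>b p\<bar> *v column k (V p) = rayleigh_quotients (b p) (V p) $ k *\<^sub>R column k (V p)})"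
    by (auto simp: diagonalizes_def)
  also have "closed \<dots>"
    by (intro closed_INT ballI closed_Collect_eq continuous_intros continuous_on_laplacian_abs_mult
        continuous_on_column continuous_on_rayleigh_quotients assms)
  finally show ?thesis .
qed

definition lla_next ::
  "(real \<Rightarrow> real) \<Rightarrow> real ^ ('d::card2) edge \<Rightarrow> real ^ ('d::card2) edge \<Rightarrow> real ^ 'd::card2 ^ 'd::card2 \<Rightarrow> real ^ ('d::card2) edge" where
  "lla_next g y b V = lla_update g y V (rayleigh_quotients b V)"

lemma lla_step_iff_lla_next:
  assumes "\<And>t. 0 \<le> t \<Longrightarrow> 0 \<le> pen_deriv g t"
  shows "lla_step (ls_loss y) g b b' \<longleftrightarrow>
    (\<exists>V. orthogonal_matrix V \<and> diagonalizes V b \<and> b' = lla_next g y b V)"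
proof -
  have "eigenbasis (laplacian \<bar>b\<bar>) V \<Lambda> \<longleftrightarrow>
    orthogonal_matrix V \<and> diagonalizes V b \<and> \<Lambda> = rayleigh_quotients b V" for V \<Lambda>
    using eigenbasis_rayleigh_quotients[of b V \<Lambda>] by (auto simp: diagonalizes_def eigenbasis_def)
  then show ?thesis by (auto simp: lla_step_iff[OF assms] lla_next_def)
qed

lemma continuous_on_lla_next:
  fixes y b :: "'p::topological_space \<Rightarrow> real ^ ('d::card2) edge"
  assumes pen: "continuous_on {0..} (pen_deriv g)"
    and y: "continuous_on S y" and b: "continuous_on S b" and V: "continuous_on S V"
  shows "continuous_on S (\<lambda>p. lla_next g (y p) (b p) (V p))"
proof -
  define m where "m e p = edge_weights (V p) (\<chi> k. pen_deriv g (rayleigh_quotients (b p) (V p) $ k)) $ e"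
    for e p
  have m: "continuous_on S (m e)" for e
  proof -
    obtain i j where ij: "i \<noteq> j" "e = edge i j" by (rule edge_exhaust)
    have "continuous_on S (\<lambda>p. pen_deriv g (rayleigh_quotients (b p) (V p) $ k))" for k
      by (rule continuous_on_compose2[OF pen])
        (auto intro!: continuous_intros continuous_on_rayleigh_quotients b V rayleigh_quotients_nonneg)
    then show ?thesis
      unfolding m_def ij(2) edge_weights_nth[OF ij(1)] using V by (auto intro!: continuous_intros)
  qed
  have "lla_next g (y p) (b p) (V p) =
      (\<chi> e. max 0 (y p $ e - m e p / 2) - max 0 (- y p $ e - m e p / 2))" for p
    by (simp add: lla_next_def lla_update_def soft_threshold_def m_def)
  then show ?thesis using y m by (auto intro!: continuous_intros)
qed

lemma continuous_on_block_oracle: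
  assumes "continuous_on S y"
  shows "continuous_on S (\<lambda>p. block_oracle \<beta>s (y p))"
proof -
  have "continuous_on S (\<lambda>p. if e \<in> within_pairs \<beta>s then y p $ e else 0)" for e
    using assms by (cases "e \<in> within_pairs \<beta>s") (auto intro!: continuous_intros)
  moreover have "block_oracle \<beta>s (y p) = (\<chi> e. if e \<in> within_pairs \<beta>s then y p $ e else 0)" for p
    by (simp add: vec_eq_iff block_oracle_nth)
  ultimately show ?thesis by (auto intro!: continuous_intros)
qed

text \<open>
  The condition \<open>h \<noteq> 0\<close> is a countable union of closed conditions \<open>\<bar>h\<bar> \<ge> 1 / (n + 1)\<close>, and projecting
  along a compact factor preserves closedness. Projections of arbitrary Borel sets need not be Borel.
\<close>

lemma borel_projection_along_compact:
  fixes K :: "'a::euclidean_space set" and C :: "('a \<times> 'b::euclidean_space) set"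
    and h :: "'a \<times> 'b \<Rightarrow> real"
  assumes "compact K" "closed C" "continuous_on UNIV h"
  shows "{p. \<exists>q\<in>K. (q, p) \<in> C \<and> h (q, p) \<noteq> 0} \<in> sets borel"
proof -
  have eq: "{p. \<exists>q\<in>K. (q, p) \<in> C \<and> h (q, p) \<noteq> 0}
    = (\<Union>n. {p. \<exists>q. q \<in> K \<and> (q, p) \<in> C \<inter> {z. 1 / real (Suc n) \<le> \<bar>h z\<bar>}})" (is "?L = ?R")
  proof
    show "?L \<subseteq> ?R"
    proof
      fix p assume "p \<in> ?L"
      then obtain q where q: "q \<in> K" "(q, p) \<in> C" "h (q, p) \<noteq> 0" by blast
      then obtain n where "1 / real (Suc n) < \<bar>h (q, p)\<bar>"
        using nat_approx_posE[of "\<bar>h (q, p)\<bar>"] by (auto simp: inverse_eq_divide)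
      with q show "p \<in> ?R" by (auto intro!: exI[of _ n] exI[of _ q])
    qed
    show "?R \<subseteq> ?L"
    proof
      fix p assume "p \<in> ?R"
      then obtain n q where q: "q \<in> K" "(q, p) \<in> C" "1 / real (Suc n) \<le> \<bar>h (q, p)\<bar>" by blast
      moreover have "0 < 1 / real (Suc n)" by simp
      ultimately have "h (q, p) \<noteq> 0" by fastforce
      with q show "p \<in> ?L" by blast
    qed
  qed
  have "closed {p. \<exists>q. q \<in> K \<and> (q, p) \<in> C \<inter> {z. 1 / real (Suc n) \<le> \<bar>h z\<bar>}}" for n
    by (intro closed_compact_projection assms closed_Int closed_Collect_le continuous_intros)
  then show ?thesis unfolding eq by (intro sets.countable_UN) auto
qed

lemma borel_lla_converges:
  fixes \<beta>s :: "real ^ ('d::card2) edge"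
  assumes pen: "continuous_on {0..} (pen_deriv g)" and nonneg: "\<And>t. 0 \<le> t \<Longrightarrow> 0 \<le> pen_deriv g t"
  shows "{(y, b0). lla_converges_after_two_steps (ls_loss y) g b0 (block_oracle \<beta>s y)} \<in> sets borel"
proof -
  let ?O = "{V :: real^'d::card2^'d::card2. orthogonal_matrix V}"
  let ?x = "block_oracle \<beta>s"
  define C1 where "C1 = {((V1, V2), (y, b0 :: real^'d edge)). diagonalizes V1 b0 \<and> diagonalizes V2 (lla_next g y b0 V1)}"
  define h1 where "h1 = (\<lambda>((V1, V2), (y, b0 :: real^'d edge)). norm (lla_next g y (lla_next g y b0 V1) V2 - ?x y))"
  define C2 where "C2 = {(V, (y, b0 :: real^'d edge)). diagonalizes V (?x y)}"
  define h2 where "h2 = (\<lambda>(V, (y, b0 :: real^'d edge)). norm (lla_next g y (?x y) V - ?x y))"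
  let ?B1 = "{p. \<exists>q\<in>?O \<times> ?O. (q, p) \<in> C1 \<and> h1 (q, p) \<noteq> 0}"
  let ?B2 = "{p. \<exists>q\<in>?O. (q, p) \<in> C2 \<and> h2 (q, p) \<noteq> 0}"
  have "?B1 \<in> sets borel"
  proof (rule borel_projection_along_compact)
    show "compact (?O \<times> ?O)" by (intro compact_Times compact_orthogonal_matrices)
    have "C1 = {z. diagonalizes (fst (fst z)) (snd (snd z))} \<inter>
        {z. diagonalizes (snd (fst z)) (lla_next g (fst (snd z)) (snd (snd z)) (fst (fst z)))}"
      by (auto simp: C1_def)
    then show "closed C1"
      by (simp only:) (intro closed_Int closed_diagonalizes continuous_on_lla_next[OF pen] continuous_intros)
    show "continuous_on UNIV h1" unfolding h1_def case_prod_beta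
      by (intro continuous_on_lla_next[OF pen] continuous_on_block_oracle continuous_intros)
  qed
  moreover have "?B2 \<in> sets borel"
  proof (rule borel_projection_along_compact)
    show "compact ?O" by (rule compact_orthogonal_matrices)
    have "C2 = {z. diagonalizes (fst z) (?x (fst (snd z)))}" by (auto simp: C2_def)
    then show "closed C2"
      by (simp only:) (intro closed_diagonalizes continuous_on_block_oracle continuous_intros)
    show "continuous_on UNIV h2" unfolding h2_def case_prod_beta
      by (intro continuous_on_lla_next[OF pen] continuous_on_block_oracle continuous_intros)
  qed
  ultimately have "- (?B1 \<union> ?B2) \<in> sets borel" by (intro borel_comp sets.Un)
  moreover have "{(y, b0). lla_converges_after_two_steps (ls_loss y) g b0 (?x y)} = - (?B1 \<union> ?B2)"
  proof -
    have total: "\<exists>b'. lla_step (ls_loss y) g b b'" for y b :: "real^'d edge"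
      by (rule lla_step_total[OF nonneg])
    have step: "lla_step (ls_loss y) g b b' \<longleftrightarrow>
      (\<exists>V. orthogonal_matrix V \<and> diagonalizes V b \<and> b' = lla_next g y b V)" for y b b' :: "real^'d edge"
      by (rule lla_step_iff_lla_next[OF nonneg])
    have "lla_converges_after_two_steps (ls_loss y) g b0 (?x y) \<longleftrightarrow> (y, b0) \<notin> ?B1 \<and> (y, b0) \<notin> ?B2" for y b0
      unfolding lla_converges_iff[of "ls_loss y" g, OF total] step
      by (auto simp: C1_def C2_def h1_def h2_def)
    then show ?thesis by auto
  qed
  ultimately show ?thesis by simp
qed

text \<open>
  Each sublevel set is an intersection of closed conditions, one for every vector to which the matrix
  is applied.
\<close>

lemma borel_measurable_spectral_norm_laplacian_diff:
  fixes c :: "real ^ ('d::card2) edge"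
  shows "(\<lambda>b. spectral_norm (laplacian (\<bar>b\<bar> - \<bar>c\<bar>))) \<in> borel_measurable borel"
proof (rule borel_measurableI_le)
  fix a :: real
  have "onorm ((*v) A) \<le> a \<longleftrightarrow> (\<forall>x. norm (A *v x) \<le> a * norm x)" for A :: "real^'d::card2^'d::card2"
    using onorm[OF matrix_vector_mul_bounded_linear, of A] onorm_le[of "(*v) A" a]
    by (meson mult_right_mono norm_ge_zero order_trans)
  then have "{b. spectral_norm (laplacian (\<bar>b\<bar> - \<bar>c\<bar>)) \<le> a}
    = (\<Inter>x. {b. norm (laplacian \<bar>b\<bar> *v x - laplacian \<bar>c\<bar> *v x) \<le> a * norm x})"
    by (auto simp: spectral_norm_def laplacian_diff_mult)
  also have "closed \<dots>"
    by (intro closed_INT ballI closed_Collect_le continuous_intros continuous_on_laplacian_abs_mult)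
  finally show "{b \<in> space borel. spectral_norm (laplacian (\<bar>b\<bar> - \<bar>c\<bar>)) \<le> a} \<in> sets borel"
    by simp
qed

section \<open>Probability of convergence\<close>

theorem theorem4p2:
  fixes M :: "'o measure"
    and \<beta>ok \<beta>init :: "'o \<Rightarrow> real ^ ('d::card2) edge"
    and \<beta>s :: "real ^ 'd edge"
    and f :: "nat \<Rightarrow> real \<Rightarrow> real" and n :: nat
    and g :: "real \<Rightarrow> real"
    and a0 a1 b1 b2 \<tau> v \<rho> :: real
  assumes "prob_space M"
    and "\<beta>ok \<in> borel_measurable M" and "\<beta>init \<in> borel_measurable M"
    and "\<beta>s \<noteq> 0"
    and "a0 \<ge> a1" and "a1 > 0" and "b2 > b1" and "b1 > 0"
    and "scad_like a0 a1 b1 b2 \<tau> g"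
    and "v \<ge> 0" and "tail_function v f"
    and "residual_tail_condition M f v n \<beta>s \<beta>ok"
    and "eigenvalue_nth (card (graph_components \<beta>s) + 1) (laplacian \<bar>\<beta>s\<bar>) \<ge> (b1 + b2) * \<tau>"
    and "\<rho> \<ge> 0"
    and "\<rho> \<le> sqrt (b1 / (2^7 * a0 * real (max_component_size \<beta>s)))"
    and "ereal (max (a1 * \<tau> / 4) (b1 * \<tau> / (4 * real (max_component_size \<beta>s)))) \<le> 1 / ereal v"
  shows "let dmax = real (max_component_size \<beta>s);
             D = real CARD('d edge);
             S = real (card (within_pairs \<beta>s));
             C = Min {\<rho>, 1 / 2^6 * sqrt (a1 / (a0 * dmax)), b1 / (b1 + b2)} * (b1 + b2);
             \<delta>1 = \<P>(\<omega> in M. spectral_norm (laplacian (\<bar>\<beta>init \<omega>\<bar> - \<bar>\<beta>s\<bar>)) \<ge> C * \<tau>);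
             \<delta>2 = (D - S) * f n (a1 * \<tau> / (4 * dmax));
             \<delta>3 = S * f n (b1 * \<tau> / (4 * dmax))
         in \<P>(\<omega> in M. lla_converges_after_two_steps (ls_loss (\<beta>ok \<omega>)) g (\<beta>init \<omega>)
                 (block_oracle \<beta>s (\<beta>ok \<omega>))) \<ge> 1 - \<delta>1 - \<delta>2 - \<delta>3"
proof -
  interpret prob_space M by fact
  note g = \<open>scad_like a0 a1 b1 b2 \<tau> g\<close>
  note [measurable] = assms(2,3)
  define d where "d = real (max_component_size \<beta>s)"
  define S where "S = within_pairs \<beta>s"
  define C where "C = Min {\<rho>, 1 / 2^6 * sqrt (a1 / (a0 * d)), b1 / (b1 + b2)} * (b1 + b2)"
  define far where "far = {\<omega> \<in> space M. spectral_norm (laplacian (\<bar>\<beta>init \<omega>\<bar> - \<bar>\<beta>s\<bar>)) \<ge> C * \<tau>}"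
  define conv where "conv = {\<omega> \<in> space M. lla_converges_after_two_steps (ls_loss (\<beta>ok \<omega>)) g (\<beta>init \<omega>)
    (block_oracle \<beta>s (\<beta>ok \<omega>))}"
  define dev where "dev t e = {\<omega> \<in> space M. t < \<bar>\<beta>ok \<omega> $ e - \<beta>s $ e\<bar>}" for t e
  define t1 where "t1 = a1 * \<tau> / (4 * d)"
  define t2 where "t2 = b1 * \<tau> / (4 * d)"
  have d2: "2 \<le> d" using two_le_max_component_size[OF \<open>\<beta>s \<noteq> 0\<close>] by (simp add: d_def)
  have nonneg: "0 \<le> pen_deriv g t" if "0 \<le> t" for t
    by (rule scad_like_pen_deriv_nonneg[OF g that])
  have "0 \<le> a0 * \<tau>" using nonneg[of 0] scad_like_pen_deriv_0[OF g] by simp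
  then have \<tau>: "0 \<le> \<tau>" using assms(5,6) by (simp add: zero_le_mult_iff)
  have cardS: "card (- S) = CARD('d edge) - card S"
    by (simp add: Compl_eq_Diff_UNIV card_Diff_subset)
  have S_le: "card S \<le> CARD('d edge)" by (rule card_mono) auto
  have "prob conv \<ge> 1 - prob far - (real CARD('d edge) - real (card S)) * f n t1 - real (card S) * f n t2"
  proof (cases "\<tau> = 0")
    \<comment> \<open>At \<open>\<tau> = 0\<close> both tail values are taken at \<open>t = 0\<close>, where the tail function is \<open>1\<close> by
      convention; the asserted lower bound is then at most \<open>1 - CARD('d edge) \<le> 0\<close>.\<close>
    case True
    have "0 \<notin> tail_range v" by (simp add: tail_range_def)
    then have "f n t1 = 1" "f n t2 = 1"
      using \<open>tail_function v f\<close> True by (auto simp: tail_function_def t1_def t2_def)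
    moreover have "1 - prob far - real CARD('d edge) \<le> prob conv"
    proof -
      have "1 \<le> real CARD('d edge)" by (simp add: Suc_leI)
      then show ?thesis using measure_nonneg[of M conv] measure_nonneg[of M far] by linarith
    qed
    ultimately show ?thesis by (simp add: algebra_simps)
  next
    case False
    with \<tau> have pos: "0 < \<tau>" by simp
    have "t1 \<le> a1 * \<tau> / 4"
      using d2 assms(6) pos unfolding t1_def by (intro divide_left_mono) auto
    then have "t1 \<le> max (a1 * \<tau> / 4) (b1 * \<tau> / (4 * real (max_component_size \<beta>s)))"
        "t2 \<le> max (a1 * \<tau> / 4) (b1 * \<tau> / (4 * real (max_component_size \<beta>s)))"
      by (auto simp: t2_def d_def)
    then have "ereal t1 \<le> 1 / ereal v" "ereal t2 \<le> 1 / ereal v"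
      using order_trans[OF ereal_less_eq(3)[THEN iffD2] assms(16)] by blast+
    then have t: "t1 \<in> tail_range v" "t2 \<in> tail_range v"
      using assms(6,8) pos d2 by (auto simp: tail_range_def t1_def t2_def)
    have dev_le: "prob (dev t e) \<le> f n t" if "t \<in> tail_range v" for t e
      using assms(12) that by (simp add: residual_tail_condition_def dev_def)
    have dev_meas[measurable]: "dev t e \<in> events" for t e
      unfolding dev_def by measurable
    have far_meas[measurable]: "far \<in> events"
    proof -
      have "(\<lambda>\<omega>. spectral_norm (laplacian (\<bar>\<beta>init \<omega>\<bar> - \<bar>\<beta>s\<bar>))) \<in> borel_measurable M"
        by (rule measurable_compose[OF assms(3) borel_measurable_spectral_norm_laplacian_diff])
      then show ?thesis unfolding far_def by measurable
    qed
    have conv_meas[measurable]: "conv \<in> events"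
    proof -
      have "(\<lambda>\<omega>. (\<beta>ok \<omega>, \<beta>init \<omega>)) \<in> borel_measurable M"
        by (intro borel_measurable_Pair assms)
      from measurable_sets[OF this borel_lla_converges[OF scad_like_pen_deriv_continuous[OF g] nonneg, of \<beta>s]]
      show ?thesis by (simp add: conv_def vimage_def Int_def conj_commute)
    qed
    let ?off = "\<Union>e\<in>-S. dev t1 e" and ?on = "\<Union>e\<in>S. dev t2 e"
    have "space M \<subseteq> conv \<union> far \<union> ?off \<union> ?on"
    proof
      fix \<omega> assume \<omega>: "\<omega> \<in> space M"
      show "\<omega> \<in> conv \<union> far \<union> ?off \<union> ?on"
      proof (rule ccontr)
        assume n: "\<omega> \<notin> conv \<union> far \<union> ?off \<union> ?on"
        have "lla_converges_after_two_steps (ls_loss (\<beta>ok \<omega>)) g (\<beta>init \<omega>) (block_oracle \<beta>s (\<beta>ok \<omega>))"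
        proof (rule lla_converges_on_good_event[OF g assms(5,6,7,8) pos d_def \<open>\<beta>s \<noteq> 0\<close> assms(13,14)])
          show "\<rho> \<le> sqrt (b1 / (2^7 * a0 * d))" using assms(15) by (simp add: d_def)
        qed (use n \<omega> in \<open>auto simp: far_def dev_def S_def t1_def t2_def C_def not_le not_less\<close>)
        with n \<omega> show False by (simp add: conv_def)
      qed
    qed
    then have "1 \<le> prob (conv \<union> far \<union> ?off \<union> ?on)"
      using prob_space finite_measure_mono[of "space M" "conv \<union> far \<union> ?off \<union> ?on"] by simp
    also have "\<dots> \<le> prob conv + prob far + prob ?off + prob ?on"
    proof -
      have off: "?off \<in> events" and on: "?on \<in> events" by auto
      show ?thesis
        using measure_Un_le[OF sets.Un[OF sets.Un[OF conv_meas far_meas] off] on]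
          measure_Un_le[OF sets.Un[OF conv_meas far_meas] off] measure_Un_le[OF conv_meas far_meas]
        by linarith
    qed
    also have "prob ?off \<le> (\<Sum>e\<in>-S. prob (dev t1 e))"
      by (rule measure_UNION_le) auto
    also have "\<dots> \<le> (real CARD('d edge) - real (card S)) * f n t1"
      using sum_mono[of "-S" "\<lambda>e. prob (dev t1 e)" "\<lambda>_. f n t1"] dev_le[OF t(1)] cardS S_le
      by (simp add: of_nat_diff)
    also have "prob ?on \<le> (\<Sum>e\<in>S. prob (dev t2 e))"
      by (rule measure_UNION_le) auto
    also have "\<dots> \<le> real (card S) * f n t2"
      using sum_mono[of S "\<lambda>e. prob (dev t2 e)" "\<lambda>_. f n t2"] dev_le[OF t(2)] by simp
    finally show ?thesis by simp
  qed
  then show ?thesis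
    by (simp add: Let_def conv_def far_def C_def d_def S_def t1_def t2_def)
qed

end
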